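(* A function $\phi:\mathbb{R}\to\mathbb{C}$ is the characteristic function of a stable probability distribution on the real line if and only if there exist real numbers $\alpha, c, \beta, \mu$ with $0<\alpha\le 2$, $c\ge 0$ and $|\beta|\le 1$ such that $\phi(t)=\exp[\psi_{\alpha,c,\beta,\mu}(t)]$ for all real $t$, where $$\psi_{\alpha,c,\beta,\mu}(t) := i\mu t - |ct|^\alpha\bigl(1 - i\beta\,\mathrm{sign}(t)\,\omega_\alpha(t)\bigr)$$ with $$\omega_\alpha(t) = \tan\left(\tfrac{\pi}{2}\alpha\right)\ \text{ if } \alpha\neq 1,\qquad \omega_1(t) = -\tfrac{2}{\pi}\log|t| .$$
   Context: The characteristic function of a real random variable $X$ (or of its distribution) is $\phi(t)=E(e^{itX})$, $t\in\mathbb{R}$. The distribution of $X$ is called stable if for each positive integer $n$, with $X_1,\dots,X_n$ independent random variables each having the same distribution as $X$, the sum $X_1+\cdots+X_n$ has the same distribution as $a_nX+b_n$ for some real constants $a_n, b_n$ with $a_n>0$. (Degenerate distributions, concentrated at a single point, are allowed.) Here $\mathrm{sign}(t)$ equals $1$, $0$, $-1$ according to whether $t>0$, $t=0$, $t<0$; and $\psi_{\alpha,c,\beta,\mu}(0)=0$ in all cases, including $\alpha=1$. *)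

theory Defs
  imports "HOL-Probability.Probability"
begin

text \<open>
  Stability of a law \<open>M\<close> on the real line.  HOL cannot quantify over the type of the
  sample space inside a formula, so the independent copies live on probability spaces over
  \<open>nat \<Rightarrow> real\<close>.  This is no restriction: that type carries \<open>n\<close> independent copies of every
  real law (\<open>ex_indep_copies\<close>), and the defining property transfers to every other sample
  space (\<open>stable_distribution_sum\<close>).
\<close>

definition stable_distribution :: "real measure \<Rightarrow> bool" where
  "stable_distribution M \<longleftrightarrow>
     real_distribution M \<and>
     (\<forall>n::nat. n \<ge> 1 \<longrightarrow>
       (\<exists>a b :: real. a > 0 \<and>
         (\<forall>(P :: (nat \<Rightarrow> real) measure) (X :: nat \<Rightarrow> (nat \<Rightarrow> real) \<Rightarrow> real).
            prob_space P \<longrightarrow>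
            prob_space.indep_vars P (\<lambda>_. borel) X {1..n} \<longrightarrow>
            (\<forall>i\<in>{1..n}. distr P borel (X i) = M) \<longrightarrow>
            distr P borel (\<lambda>\<omega>. \<Sum>i\<in>{1..n}. X i \<omega>) = distr M borel (\<lambda>x. a * x + b))))"

lemma ex_indep_copies:
  fixes n :: nat
  assumes "real_distribution M" and n: "n \<ge> 1"
  shows "\<exists>(P :: (nat \<Rightarrow> real) measure) X. prob_space P \<and>
           prob_space.indep_vars P (\<lambda>_. borel) X {1..n} \<and>
           (\<forall>i\<in>{1..n}. distr P borel (X i) = M)"
proof -
  interpret M: real_distribution M by fact
  let ?P = "Pi\<^sub>M {1..n} (\<lambda>_. M)"
  let ?X = "\<lambda>i (\<omega>::nat \<Rightarrow> real). \<omega> i"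
  let ?B = "Pi\<^sub>M {1..n} (\<lambda>_. borel :: real measure)"
  interpret P: prob_space ?P
    by (rule prob_space_PiM) (rule M.prob_space_axioms)
  have rv: "?X i \<in> measurable ?P borel" if "i \<in> {1..n}" for i
  proof -
    have "?X i \<in> measurable ?P M" using that by (rule measurable_component_singleton)
    then show ?thesis by (simp only: measurable_cong_sets[OF refl M.events_eq_borel])
  qed
  have d: "distr ?P borel (?X i) = M" if "i \<in> {1..n}" for i
  proof -
    have "distr ?P borel (?X i) = distr ?P M (?X i)"
      by (rule distr_cong) (simp_all only: M.events_eq_borel)
    also have "\<dots> = M" using M.prob_space_axioms that by (rule distr_PiM_component)
    finally show ?thesis .
  qed
  have "distr ?P ?B (\<lambda>\<omega>. \<lambda>i\<in>{1..n}. ?X i \<omega>) = distr ?P ?P (\<lambda>\<omega>. \<omega>)"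
  proof (rule distr_cong)
    show "sets ?B = sets ?P" by (rule sets_PiM_cong) (simp_all only: M.events_eq_borel)
    show "(\<lambda>i\<in>{1..n}. ?X i x) = x" if "x \<in> space ?P" for x
      using that unfolding space_PiM by (rule PiE_restrict)
  qed (rule refl)
  also have "\<dots> = ?P" by (rule distr_id)
  also have "\<dots> = Pi\<^sub>M {1..n} (\<lambda>i. distr ?P borel (?X i))"
    by (intro PiM_cong refl d[symmetric])
  finally have J: "distr ?P ?B (\<lambda>\<omega>. \<lambda>i\<in>{1..n}. ?X i \<omega>) =
    Pi\<^sub>M {1..n} (\<lambda>i. distr ?P borel (?X i))" .
  have "{1..n} \<noteq> {}" using n by simp
  then have "P.indep_vars (\<lambda>_. borel) ?X {1..n}"
    using J rv P.indep_vars_iff_distr_eq_PiM'[where I = "{1..n}" and M' = "\<lambda>_. borel" and X = ?X] by blast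
  then show ?thesis using d P.prob_space_axioms by blast
qed

lemma distr_sum_indep_copies:
  assumes P: "prob_space P" and n: "n \<ge> 1"
    and ind: "prob_space.indep_vars P (\<lambda>_. borel) X {1..n}"
    and d: "\<forall>i\<in>{1..n}. distr P borel (X i) = (M :: real measure)"
  shows "distr P borel (\<lambda>\<omega>. \<Sum>i\<in>{1..n}. X i \<omega>) =
         distr (Pi\<^sub>M {1..n} (\<lambda>_. M)) borel (\<lambda>x. \<Sum>i\<in>{1..n::nat}. x i)"
proof -
  interpret prob_space P by fact
  have rv: "X i \<in> measurable P borel" if "i \<in> {1..n}" for i
    using ind that by (auto simp: indep_vars_def)
  let ?J = "\<lambda>\<omega>. \<lambda>i\<in>{1..n}. X i \<omega>"
  let ?B = "Pi\<^sub>M {1..n} (\<lambda>_. borel :: real measure)"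
  have "distr P ?B ?J = Pi\<^sub>M {1..n} (\<lambda>i. distr P borel (X i))"
    using n ind by (subst (asm) indep_vars_iff_distr_eq_PiM') (use rv in auto)
  also have "\<dots> = Pi\<^sub>M {1..n} (\<lambda>_. M)"
    using d by (intro PiM_cong) auto
  finally have J: "distr P ?B ?J = Pi\<^sub>M {1..n} (\<lambda>_. M)" .
  have m: "?J \<in> measurable P ?B" using rv by (intro measurable_restrict) auto
  have "distr (distr P ?B ?J) borel (\<lambda>x. \<Sum>i\<in>{1..n}. x i) =
        distr P borel ((\<lambda>x. \<Sum>i\<in>{1..n}. x i) \<circ> ?J)"
    by (rule distr_distr[OF _ m]) (auto intro!: borel_measurable_sum measurable_component_singleton)
  also have "\<dots> = distr P borel (\<lambda>\<omega>. \<Sum>i\<in>{1..n}. X i \<omega>)"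
    by (rule distr_cong) auto
  finally show ?thesis by (simp only: J)
qed

lemma stable_distribution_sum:
  assumes "stable_distribution M" and "n \<ge> 1"
  shows "\<exists>a b. a > 0 \<and>
           (\<forall>(P :: 'a measure) X. prob_space P \<longrightarrow>
              prob_space.indep_vars P (\<lambda>_. borel) X {1..n::nat} \<longrightarrow>
              (\<forall>i\<in>{1..n}. distr P borel (X i) = M) \<longrightarrow>
              distr P borel (\<lambda>\<omega>. \<Sum>i\<in>{1..n}. X i \<omega>) = distr M borel (\<lambda>x. a * x + b))"
proof -
  from assms have M: "real_distribution M" by (simp add: stable_distribution_def)
  obtain P :: "(nat \<Rightarrow> real) measure" and X where
    P: "prob_space P" "prob_space.indep_vars P (\<lambda>_. borel) X {1..n}"
       "\<forall>i\<in>{1..n}. distr P borel (X i) = M"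
    using ex_indep_copies[OF M assms(2)] by blast
  obtain a b where ab: "a > 0"
    "distr P borel (\<lambda>\<omega>. \<Sum>i\<in>{1..n}. X i \<omega>) = distr M borel (\<lambda>x. a * x + b)"
    using assms P unfolding stable_distribution_def by meson
  have "distr Q borel (\<lambda>\<omega>. \<Sum>i\<in>{1..n}. Y i \<omega>) = distr M borel (\<lambda>x. a * x + b)"
    if Q: "prob_space Q" "prob_space.indep_vars Q (\<lambda>_. borel) Y {1..n}"
      "\<forall>i\<in>{1..n}. distr Q borel (Y i) = M" for Q :: "'a measure" and Y
    using ab(2) distr_sum_indep_copies[OF P(1) assms(2) P(2,3)]
      distr_sum_indep_copies[OF Q(1) assms(2) Q(2,3)] by (simp only:)
  with ab(1) show ?thesis by blast
qed

definition stable_omega :: "real \<Rightarrow> real \<Rightarrow> real" where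
  "stable_omega \<alpha> t = (if \<alpha> = 1 then - (2 / pi) * ln \<bar>t\<bar> else tan (pi / 2 * \<alpha>))"

definition stable_psi :: "real \<Rightarrow> real \<Rightarrow> real \<Rightarrow> real \<Rightarrow> real \<Rightarrow> complex" where
  "stable_psi \<alpha> c \<beta> \<mu> t =
     \<i> * of_real (\<mu> * t)
     - of_real (\<bar>c * t\<bar> powr \<alpha>) * (1 - \<i> * of_real (\<beta> * sgn t * stable_omega \<alpha> t))"

text \<open>
  The convention that the exponent vanishes at \<open>0\<close> holds automatically, because
  \<open>0 powr \<alpha> = 0\<close> and \<open>ln 0\<close> is a real number in HOL.
\<close>

lemma stable_psi_0 [simp]: "stable_psi \<alpha> c \<beta> \<mu> 0 = 0"
  by (simp add: stable_psi_def)

end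

theory Submission
  imports Defs "HOL-Real_Asymp.Real_Asymp"
begin

text \<open>
  Existence: for \<open>0 < \<alpha> < 2\<close>, \<open>\<alpha> \<noteq> 1\<close>, the coefficients of \<open>(1 - z)^\<alpha>\<close> from degree 2 on all have
  the sign of \<open>\<alpha> - 1\<close>, so they are the jump intensities of lattice compound Poisson laws; rescaled
  and centred, these converge to a law with transform \<open>E (exp (- w X)) = exp (\<plusminus> \<kappa> w^\<alpha>)\<close> on
  \<open>Re w \<ge> 0\<close>. Letting \<open>\<alpha>\<close> tend to 1 in \<open>(w^\<alpha> - w) / (\<alpha> - 1)\<close> gives \<open>exp (\<kappa> w ln w)\<close>. These are the
  totally skewed laws; the others are convolutions of one of them with a reflected one.

  Necessity: stability reads \<open>\<phi>(t)^n = exp (i b\<^sub>n t) \<phi>(a\<^sub>n t)\<close>, so \<open>\<phi>\<close> has no zeros and has a continuous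
  logarithm \<open>- R + i \<theta>\<close>. Comparing powers gives \<open>a\<^sub>n = n^(1/\<alpha>)\<close>, and density of the rationals turns
  the relations into functional equations with solutions \<open>R(t) = C t^\<alpha>\<close> and
  \<open>\<theta>(t) = \<mu> t + k t^\<alpha>\<close> (or \<open>\<mu> t + k t ln t\<close>). For \<open>\<alpha> \<ge> 2\<close> a finite variance forces \<open>\<alpha> = 2\<close> and
  \<open>k = 0\<close>. For \<open>\<alpha> < 2\<close>, \<open>\<beta> > 1\<close> is refuted by convolving with a totally skewed law.
\<close>

section \<open>Transforms of laws on the line\<close>

lemma real_distribution_convolution:
  assumes "real_distribution M" "real_distribution N"
  shows "real_distribution (M \<star> N)"
proof -
  interpret M: real_distribution M by fact
  interpret N: real_distribution N by fact
  interpret MN: pair_prob_space M N ..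
  show ?thesis
    unfolding convolution_def by (rule MN.real_distribution_distr) simp
qed

lemma char_convolution:
  assumes "real_distribution M" "real_distribution N"
  shows "char (M \<star> N) t = char M t * char N t"
proof -
  interpret M: real_distribution M by fact
  interpret N: real_distribution N by fact
  interpret MN: pair_prob_space M N ..
  have "char (M \<star> N) t = (CLINT z|M \<Otimes>\<^sub>M N. iexp (t * fst z) * iexp (t * snd z))"
    unfolding char_def convolution_def
    by (subst integral_distr) (auto simp: case_prod_beta distrib_left exp_add)
  also have "\<dots> = (CLINT x|M. CLINT y|N. iexp (t * x) * iexp (t * y))"
    by (subst MN.integral_fst'[symmetric])
       (auto intro!: MN.P.integrable_const_bound[of _ 1] simp: norm_mult)
  also have "\<dots> = char M t * char N t"
    by (simp add: char_def)
  finally show ?thesis .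
qed

text \<open>Phrased with nonnegative integrals so that infinite moments are covered;
  \<open>skewness_le_1\<close> uses it to pass from a finite product to a finite factor.\<close>

lemma nn_integral_exp_convolution:
  assumes "real_distribution M" "real_distribution N"
  shows "(\<integral>\<^sup>+x. ennreal (exp (s * x)) \<partial>(M \<star> N)) =
    (\<integral>\<^sup>+x. ennreal (exp (s * x)) \<partial>M) * (\<integral>\<^sup>+x. ennreal (exp (s * x)) \<partial>N)"
proof -
  interpret M: real_distribution M by fact
  interpret N: real_distribution N by fact
  have "(\<integral>\<^sup>+x. ennreal (exp (s * x)) \<partial>(M \<star> N)) =
      (\<integral>\<^sup>+x. \<integral>\<^sup>+y. ennreal (exp (s * x)) * ennreal (exp (s * y)) \<partial>N \<partial>M)"
    using M.finite_measure_axioms N.finite_measure_axioms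
    by (subst nn_integral_convolution) (auto simp: distrib_left exp_add ennreal_mult)
  then show ?thesis
    by (simp add: nn_integral_cmult nn_integral_multc)
qed

lemma char_affine:
  assumes "real_distribution M"
  shows "char (distr M borel (\<lambda>x. a * x + b)) t = iexp (b * t) * char M (a * t)"
proof -
  interpret real_distribution M by fact
  show ?thesis
    unfolding char_def
    by (subst integral_distr) (auto simp: exp_add algebra_simps simp flip: integral_mult_right_zero)
qed

text \<open>\<open>F\<close> plays the role of \<open>w \<mapsto> E (exp (- w X))\<close> on the closed right half plane.\<close>

definition laplace_law :: "(complex \<Rightarrow> complex) \<Rightarrow> bool" where
  "laplace_law F \<longleftrightarrow> (\<exists>M. real_distribution M \<and> (\<forall>t. char M t = F (- (\<i> * of_real t))) \<and>
     (\<forall>s>0. (\<integral>\<^sup>+x. ennreal (exp (- s * x)) \<partial>M) \<le> ennreal (cmod (F (of_real s)))))"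

lemma laplace_law_mult:
  assumes "laplace_law F" "laplace_law G"
  shows "laplace_law (\<lambda>w. F w * G w)"
proof -
  from assms obtain M N where M: "real_distribution M" "\<And>t. char M t = F (- (\<i> * of_real t))"
      "\<And>s. s > 0 \<Longrightarrow> (\<integral>\<^sup>+x. ennreal (exp (- s * x)) \<partial>M) \<le> ennreal (cmod (F (of_real s)))"
    and N: "real_distribution N" "\<And>t. char N t = G (- (\<i> * of_real t))"
      "\<And>s. s > 0 \<Longrightarrow> (\<integral>\<^sup>+x. ennreal (exp (- s * x)) \<partial>N) \<le> ennreal (cmod (G (of_real s)))"
    unfolding laplace_law_def by metis
  show ?thesis
    unfolding laplace_law_def
  proof (intro exI conjI allI impI)
    show "real_distribution (M \<star> N)"
      using M N by (intro real_distribution_convolution)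
    show "char (M \<star> N) t = F (- (\<i> * of_real t)) * G (- (\<i> * of_real t))" for t
      using M N by (simp add: char_convolution)
    show "(\<integral>\<^sup>+x. ennreal (exp (- s * x)) \<partial>(M \<star> N)) \<le> ennreal (cmod (F (of_real s) * G (of_real s)))"
      if "s > 0" for s
      unfolding nn_integral_exp_convolution[OF M(1) N(1)] norm_mult
      using M(3)[OF that] N(3)[OF that] by (simp add: ennreal_mult mult_mono)
  qed
qed

lemma laplace_law_exp: "laplace_law (\<lambda>w. exp (of_real a * w))"
  unfolding laplace_law_def
proof (intro exI conjI allI impI)
  interpret prob_space "return borel (- a)"
    by (rule prob_space_return) simp
  show "real_distribution (return borel (- a))"
    by unfold_locales simp
  show "char (return borel (- a)) t = exp (of_real a * - (\<i> * of_real t))" for t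
    by (simp add: char_def integral_return mult_ac)
  show "(\<integral>\<^sup>+x. ennreal (exp (- s * x)) \<partial>return borel (- a)) \<le> ennreal (cmod (exp (of_real a * of_real s)))" for s
    by (subst nn_integral_return) (auto simp: mult_ac)
qed

lemma laplace_law_power:
  assumes "laplace_law F"
  shows "laplace_law (\<lambda>w. F w ^ n)"
proof (induction n)
  case 0
  then show ?case using laplace_law_exp[of 0] by simp
qed (simp add: laplace_law_mult assms)

lemma laplace_law_scale:
  assumes "laplace_law F" "a > 0"
  shows "laplace_law (\<lambda>w. F (of_real a * w))"
proof -
  from assms obtain M where M: "real_distribution M" "\<And>t. char M t = F (- (\<i> * of_real t))"
      "\<And>s. s > 0 \<Longrightarrow> (\<integral>\<^sup>+x. ennreal (exp (- s * x)) \<partial>M) \<le> ennreal (cmod (F (of_real s)))"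
    unfolding laplace_law_def by metis
  interpret real_distribution M by (rule M)
  show ?thesis
    unfolding laplace_law_def
  proof (intro exI conjI allI impI)
    show "real_distribution (distr M borel (\<lambda>x. a * x + 0))"
      by (rule real_distribution_distr) simp
    show "char (distr M borel (\<lambda>x. a * x + 0)) t = F (of_real a * - (\<i> * of_real t))" for t
      unfolding char_affine[OF M(1)] by (simp add: M(2) mult_ac)
    show "(\<integral>\<^sup>+x. ennreal (exp (- s * x)) \<partial>distr M borel (\<lambda>x. a * x + 0)) \<le>
        ennreal (cmod (F (of_real a * of_real s)))" if "s > 0" for s
      using M(3)[of "a * s"] that \<open>a > 0\<close> by (subst nn_integral_distr) (auto simp: mult_ac)
  qed
qed

lemma sums_of_real_complexD:
  assumes "(\<lambda>k. complex_of_real (g k)) sums l"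
  shows "g sums Re l" "l = of_real (Re l)"
proof -
  from assms have "g sums Re l" "(\<lambda>k. 0::real) sums Im l"
    by (simp_all add: sums_complex_iff)
  then show "g sums Re l" "l = of_real (Re l)"
    using sums_unique2[OF _ sums_zero, of "Im l"] by (auto simp: complex_eq_iff)
qed

text \<open>The law lives on the naturals, with weights proportional to p k * r^k; its generating
  function f (r z) / f r is evaluated at z = exp (- w). Tilting by r < 1 keeps r z inside the disc
  of convergence up to the boundary Re w = 0.\<close>

lemma laplace_law_power_series:
  fixes p :: "nat \<Rightarrow> real" and f :: "complex \<Rightarrow> complex"
  assumes p: "\<And>k. 0 \<le> p k" and r: "0 < r" "r < 1"
    and f: "\<And>z. cmod z < 1 \<Longrightarrow> (\<lambda>k. of_real (p k) * z ^ k) sums f z"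
    and fr: "f (of_real r) \<noteq> 0"
  shows "laplace_law (\<lambda>w. f (of_real r * exp (- w)) / f (of_real r))"
proof -
  define S where "S = Re (f (of_real r))"
  have "(\<lambda>k. complex_of_real (p k * r ^ k)) sums f (of_real r)"
    using f[of "of_real r"] r by simp
  note sums = sums_of_real_complexD(1)[OF this, folded S_def]
    and fS = sums_of_real_complexD(2)[OF this, folded S_def]
  have S: "S > 0"
  proof -
    have "S \<ge> 0"
      by (rule sums_le[OF _ sums_zero sums]) (use p r in auto)
    then show ?thesis using fr fS by (cases "S = 0") auto
  qed
  define M where "M = distr (point_measure (UNIV::nat set) (\<lambda>k. ennreal (p k * r ^ k / S))) borel real"
  have norm1: "(\<lambda>k. p k * r ^ k / S) sums 1"
    using sums_divide[OF sums, of S] S by simp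
  have nn: "0 \<le> p k * r ^ k / S" for k using p r S by simp
  have "prob_space (point_measure (UNIV::nat set) (\<lambda>k. ennreal (p k * r ^ k / S)))"
  proof
    show "emeasure (point_measure UNIV (\<lambda>k. ennreal (p k * r ^ k / S)))
        (space (point_measure (UNIV::nat set) (\<lambda>k. ennreal (p k * r ^ k / S)))) = 1"
      using norm1 nn
      by (simp add: point_measure_def emeasure_density nn_integral_count_space_nat
         suminf_ennreal_eq[OF nn norm1] space_point_measure)
  qed
  then interpret P: prob_space "point_measure (UNIV::nat set) (\<lambda>k. ennreal (p k * r ^ k / S))" .
  have M: "real_distribution M"
    unfolding M_def by (rule P.real_distribution_distr) (simp add: point_measure_def)
  have "char M t = f (of_real r * exp (- (- (\<i> * of_real t)))) / f (of_real r)" for t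
  proof -
    let ?z = "of_real r * exp (\<i> * of_real t)"
    have z: "cmod ?z < 1" using r by (simp add: norm_mult)
    have "char M t = (CLINT k|count_space UNIV. of_real (p k * r ^ k / S) * iexp (t * real k))"
      unfolding char_def M_def point_measure_def using nn
      by (subst integral_distr) (auto simp: integral_density scaleR_conv_of_real)
    also have "(\<lambda>k. of_real (p k * r ^ k / S) * iexp (t * real k)) = (\<lambda>k. of_real (p k) * ?z ^ k / of_real S)"
      by (auto simp: power_mult_distrib field_simps simp flip: exp_of_nat_mult)
    also have "(CLINT k|count_space UNIV. of_real (p k) * ?z ^ k / of_real S) = (\<Sum>k. of_real (p k) * ?z ^ k / of_real S)"
    proof (rule integral_count_space_nat)
      have "summable (\<lambda>k. norm (of_real (p k) * ?z ^ k / of_real S))"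
        using norm1 nn S p r by (simp add: norm_mult norm_divide norm_power sums_iff)
      then show "integrable (count_space UNIV) (\<lambda>k. of_real (p k) * ?z ^ k / of_real S)"
        by (simp add: integrable_count_space_nat_iff)
    qed
    also have "\<dots> = f ?z / of_real S"
      using sums_divide[OF f[OF z], of "of_real S"] by (simp add: sums_iff)
    finally show ?thesis by (simp add: fS)
  qed
  moreover have "(\<integral>\<^sup>+x. ennreal (exp (- s * x)) \<partial>M) \<le>
      ennreal (cmod (f (of_real r * exp (- of_real s)) / f (of_real r)))" if "s > 0" for s
  proof -
    let ?z = "r * exp (- s)"
    have z: "cmod (of_real ?z) < 1"
    proof -
      have "r * exp (- s) < 1 * 1" using r that by (intro mult_strict_mono) auto
      then show ?thesis using r by (simp add: norm_mult)
    qed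
    have "(\<integral>\<^sup>+x. ennreal (exp (- s * x)) \<partial>M) = (\<Sum>k. ennreal (p k * r ^ k / S * exp (- s * real k)))"
      unfolding M_def point_measure_def using nn
      by (subst nn_integral_distr)
         (auto simp: nn_integral_density nn_integral_count_space_nat simp flip: ennreal_mult)
    also have "(\<lambda>k. p k * r ^ k / S * exp (- s * real k)) = (\<lambda>k. p k * ?z ^ k / S)"
    proof
      fix k
      have "exp (- s) ^ k = exp (- s * real k)" by (rule exp_of_nat2_mult[symmetric])
      then show "p k * r ^ k / S * exp (- s * real k) = p k * ?z ^ k / S"
        by (simp add: power_mult_distrib)
    qed
    finally have 1: "(\<integral>\<^sup>+x. ennreal (exp (- s * x)) \<partial>M) = (\<Sum>k. ennreal (p k * ?z ^ k / S))" .
    have "(\<lambda>k. of_real (p k * ?z ^ k)) sums f (of_real ?z)"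
      using f[OF z] by simp
    then have 2: "(\<lambda>k. p k * ?z ^ k / S) sums (Re (f (of_real ?z)) / S)"
      by (intro sums_divide sums_of_real_complexD(1))
    have nn2: "0 \<le> p k * ?z ^ k / S" for k using p r S by simp
    have "(\<Sum>k. ennreal (p k * ?z ^ k / S)) = ennreal (Re (f (of_real ?z)) / S)"
      using 2 nn2 by (intro suminf_ennreal_eq)
    also have "\<dots> \<le> ennreal (cmod (f (of_real ?z)) / S)"
      using S by (intro ennreal_leI divide_right_mono complex_Re_le_cmod) auto
    also have "cmod (f (of_real ?z)) / S = cmod (f (of_real r * exp (- of_real s)) / f (of_real r))"
      using S by (simp add: norm_divide fS exp_of_real flip: of_real_minus)
    finally show ?thesis using 1 by simp
  qed
  ultimately show ?thesis
    unfolding laplace_law_def using M by blast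
qed

section \<open>The Levy continuity theorem with existence of the limit law\<close>

lemma (in real_distribution) integrable_cos: "integrable M (\<lambda>x. cos (t * x))"
  by (rule integrable_const_bound[of _ 1]) auto

lemma (in real_distribution) Re_char: "Re (char M t) = (LINT x|M. cos (t * x))"
proof -
  have "Re (char M t) = (LINT x|M. Re (iexp (t * x)))"
    unfolding char_def by (rule integral_Re[symmetric]) (auto intro!: integrable_iexp)
  then show ?thesis
    by (simp add: Re_exp)
qed

text \<open>Averaging the characteristic function against a Gaussian of scale \<open>u\<close> replaces the
  oscillating kernel by a positive one, and so bounds the mass outside \<open>[-2/u, 2/u]\<close>.\<close>

lemma (in real_distribution) gaussian_average_char:
  "(LINT t|std_normal_distribution. Re (char M (u * t))) = (LINT x|M. exp (- (u * x)\<^sup>2 / 2))"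
proof -
  interpret N: real_distribution std_normal_distribution
    by (rule real_dist_normal_dist)
  interpret NM: pair_prob_space std_normal_distribution M ..
  have "(LINT t|std_normal_distribution. Re (char M (u * t))) =
      (LINT t|std_normal_distribution. LINT x|M. cos (u * t * x))"
    by (simp add: Re_char)
  also have "\<dots> = (LINT x|M. LINT t|std_normal_distribution. cos (u * t * x))"
    by (rule NM.Fubini_integral[symmetric])
       (auto intro!: NM.P.integrable_const_bound[of _ 1] simp: case_prod_beta)
  also have "\<dots> = (LINT x|M. Re (char std_normal_distribution (u * x)))"
    by (simp add: N.Re_char mult_ac)
  also have "\<dots> = (LINT x|M. exp (- (u * x)\<^sup>2 / 2))"
    by (simp add: char_std_normal_distribution del: of_real_exp)
  finally show ?thesis .
qed

lemma (in real_distribution) prob_tail_le: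
  assumes "u > 0"
  shows "(1 - exp (- 2)) * measure M {x. 2 / u \<le> \<bar>x\<bar>} \<le>
    1 - (LINT t|std_normal_distribution. Re (char M (u * t)))"
proof -
  have int: "integrable M (\<lambda>x. exp (- (u * x)\<^sup>2 / 2))"
    by (rule integrable_const_bound[of _ 1]) auto
  have "(1 - exp (- 2)) * measure M {x. 2 / u \<le> \<bar>x\<bar>} =
      (LINT x|M. (1 - exp (- 2 :: real)) * indicator {x. 2 / u \<le> \<bar>x\<bar>} x)"
    by simp
  also have "\<dots> \<le> (LINT x|M. 1 - exp (- (u * x)\<^sup>2 / 2))"
  proof (rule integral_mono)
    show "integrable M (\<lambda>x. (1 - exp (- 2 :: real)) * indicator {x. 2 / u \<le> \<bar>x\<bar>} x)"
      by (rule integrable_const_bound[of _ "\<bar>1 - exp (- 2 :: real)\<bar>"]) (auto simp: indicator_def)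
    show "integrable M (\<lambda>x. 1 - exp (- (u * x)\<^sup>2 / 2))"
      using int by simp
    \<comment> \<open>Where \<bar>x\<bar> \<ge> 2 / u the exponent (u x)^2 / 2 is at least 2, hence
      the factor 1 - exp (- 2).\<close>
    show "(1 - exp (- 2 :: real)) * indicator {x. 2 / u \<le> \<bar>x\<bar>} x \<le> 1 - exp (- (u * x)\<^sup>2 / 2)" for x
    proof (cases "2 / u \<le> \<bar>x\<bar>")
      case True
      then have "2 \<le> \<bar>u * x\<bar>" using assms by (simp add: field_simps abs_mult)
      then have "2\<^sup>2 \<le> \<bar>u * x\<bar>\<^sup>2" by (intro power_mono) auto
      then show ?thesis using True by simp
    qed auto
  qed
  also have "\<dots> = 1 - (LINT t|std_normal_distribution. Re (char M (u * t)))"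
    using int by (simp add: gaussian_average_char prob_space del: space_eq_univ)
  finally show ?thesis .
qed

text \<open>Dominated convergence along u = 1 / (n + 1), using continuity at 0. It speaks of a
  function \<phi> rather than a law because it is also applied to a pointwise limit not yet known to
  be a characteristic function.\<close>

lemma gaussian_average_near_1:
  fixes \<phi> :: "real \<Rightarrow> complex"
  assumes meas: "\<phi> \<in> borel_measurable borel" and bound: "\<And>t. cmod (\<phi> t) \<le> 1"
    and cont: "isCont \<phi> 0" and "\<phi> 0 = 1" and "\<epsilon> > 0"
  obtains u where "u > 0" "1 - (LINT t|std_normal_distribution. Re (\<phi> (u * t))) < \<epsilon>"
proof -
  interpret N: real_distribution std_normal_distribution
    by (rule real_dist_normal_dist)
  note [measurable] = meas
  have "(\<lambda>n. LINT t|std_normal_distribution. Re (\<phi> (1 / real (Suc n) * t))) \<longlonglongrightarrow>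
      (LINT t|std_normal_distribution. 1)"
  proof (rule integral_dominated_convergence[where w = "\<lambda>_. 1"])
    show "AE t in std_normal_distribution. (\<lambda>n. Re (\<phi> (1 / real (Suc n) * t))) \<longlonglongrightarrow> 1"
    proof (rule AE_I2)
      fix t
      have "(\<lambda>n. 1 / real (Suc n) * t) \<longlonglongrightarrow> 0 * t"
        by (intro tendsto_mult LIMSEQ_Suc[OF lim_1_over_n] tendsto_const)
      then have "(\<lambda>n. \<phi> (1 / real (Suc n) * t)) \<longlonglongrightarrow> \<phi> 0"
        using isCont_tendsto_compose[OF cont] by simp
      from tendsto_Re[OF this] show "(\<lambda>n. Re (\<phi> (1 / real (Suc n) * t))) \<longlonglongrightarrow> 1"
        by (simp add: \<open>\<phi> 0 = 1\<close>)
    qed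
    show "AE t in std_normal_distribution. norm (Re (\<phi> (1 / real (Suc n) * t))) \<le> 1" for n
      using bound by (intro AE_I2) (metis abs_Re_le_cmod order_trans real_norm_def)
  qed auto
  then have "(\<lambda>n. LINT t|std_normal_distribution. Re (\<phi> (1 / real (Suc n) * t))) \<longlonglongrightarrow> 1"
    using N.prob_space by simp
  from order_tendstoD(1)[OF this, of "1 - \<epsilon>"] \<open>\<epsilon> > 0\<close>
  obtain n where "1 - \<epsilon> < (LINT t|std_normal_distribution. Re (\<phi> (1 / real (Suc n) * t)))"
    by (auto simp: eventually_sequentially)
  then show thesis
    by (intro that[of "1 / real (Suc n)"]) auto
qed

lemma (in real_distribution) measure_Ioc_gt:
  assumes "u > 0" "2 / u < K"
    and "1 - (LINT t|std_normal_distribution. Re (char M (u * t))) < \<epsilon> * (1 - exp (- 2))"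
  shows "1 - \<epsilon> < measure M {-K<..K}"
proof -
  have "(1 - exp (- 2)) * measure M {x. 2 / u \<le> \<bar>x\<bar>} < (1 - exp (- 2)) * \<epsilon>"
    using prob_tail_le[OF \<open>u > 0\<close>] assms(3) unfolding mult.commute[of _ \<epsilon>] by linarith
  moreover have "0 < 1 - exp (- 2 :: real)" by simp
  ultimately have "measure M {x. 2 / u \<le> \<bar>x\<bar>} < \<epsilon>"
    using mult_less_cancel_left_pos by blast
  moreover have "1 - measure M {x. 2 / u \<le> \<bar>x\<bar>} = measure M (UNIV - {x. 2 / u \<le> \<bar>x\<bar>})"
    using prob_compl[of "{x. 2 / u \<le> \<bar>x\<bar>}"] by simp
  moreover have "measure M (UNIV - {x. 2 / u \<le> \<bar>x\<bar>}) \<le> measure M {-K<..K}"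
    using assms by (intro finite_measure_mono) auto
  ultimately show ?thesis by linarith
qed

text \<open>Tightness: from some index on, the Gaussian averages of \<open>char (M n)\<close> are
  close to that of \<phi>, so one scale u serves them all; the finitely many earlier laws get scales
  of their own. A subsequential limit law then has characteristic function \<phi>, and the usual
  continuity theorem gives convergence of the whole sequence.\<close>

theorem levy_continuity_existence:
  fixes M :: "nat \<Rightarrow> real measure" and \<phi> :: "real \<Rightarrow> complex"
  assumes M: "\<And>n. real_distribution (M n)"
    and lim: "\<And>t. (\<lambda>n. char (M n) t) \<longlonglongrightarrow> \<phi> t" and cont: "isCont \<phi> 0"
  obtains M' where "real_distribution M'" "char M' = \<phi>" "weak_conv_m M M'"
proof -
  interpret Mn: real_distribution "M n" for n by (rule M)
  interpret N: real_distribution std_normal_distribution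
    by (rule real_dist_normal_dist)
  have meas [measurable]: "\<phi> \<in> borel_measurable borel"
    by (rule borel_measurable_LIMSEQ_metric[OF _ lim]) simp
  have bound: "cmod (\<phi> t) \<le> 1" for t
    by (rule LIMSEQ_le_const2[OF tendsto_norm[OF lim]]) (simp add: Mn.cmod_char_le_1)
  have "\<phi> 0 = 1"
    using LIMSEQ_unique[OF lim[of 0]] by (simp add: Mn.char_zero)
  have "tight M"
    unfolding tight_def
  proof (intro conjI allI impI M)
    fix \<epsilon> :: real assume "\<epsilon> > 0"
    define \<delta> where "\<delta> = \<epsilon> * (1 - exp (- 2))"
    have "\<delta> > 0" using \<open>\<epsilon> > 0\<close> unfolding \<delta>_def by simp
    obtain u where u: "u > 0" "1 - (LINT t|std_normal_distribution. Re (\<phi> (u * t))) < \<delta>"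
      using gaussian_average_near_1[OF meas bound cont \<open>\<phi> 0 = 1\<close> \<open>\<delta> > 0\<close>] .
    have "(\<lambda>n. LINT t|std_normal_distribution. Re (char (M n) (u * t))) \<longlonglongrightarrow>
        (LINT t|std_normal_distribution. Re (\<phi> (u * t)))"
    proof (rule integral_dominated_convergence[where w = "\<lambda>_. 1"])
      show "AE t in std_normal_distribution. norm (Re (char (M n) (u * t))) \<le> 1" for n
        using Mn.cmod_char_le_1 by (intro AE_I2) (metis abs_Re_le_cmod order_trans real_norm_def)
    qed (auto intro!: tendsto_intros lim)
    from order_tendstoD(1)[OF this, of "1 - \<delta>"] u(2)
    obtain n0 where n0: "\<And>n. n \<ge> n0 \<Longrightarrow> 1 - (LINT t|std_normal_distribution. Re (char (M n) (u * t))) < \<delta>"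
      by (auto simp: eventually_sequentially algebra_simps)
    have "\<exists>v>0. 1 - (LINT t|std_normal_distribution. Re (char (M n) (v * t))) < \<delta>" for n
      using gaussian_average_near_1[OF Mn.char_measurable Mn.cmod_char_le_1 Mn.isCont_char Mn.char_zero \<open>\<delta> > 0\<close>]
      by metis
    then obtain v where v: "\<And>n. v n > 0"
        "\<And>n. 1 - (LINT t|std_normal_distribution. Re (char (M n) (v n * t))) < \<delta>"
      by metis
    \<comment> \<open>The summand 1 makes all the bounds strict, as \<open>measure_Ioc_gt\<close>
      requires.\<close>
    define K where "K = Max (insert (2 / u) ((\<lambda>n. 2 / v n) ` {..<n0})) + 1"
    have "2 / u \<le> Max (insert (2 / u) ((\<lambda>n. 2 / v n) ` {..<n0}))"
      by (intro Max_ge) auto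
    then have Ku: "2 / u < K" unfolding K_def by linarith
    have Kv: "2 / v n < K" if "n < n0" for n
    proof -
      have "2 / v n \<le> Max (insert (2 / u) ((\<lambda>n. 2 / v n) ` {..<n0}))"
        using that by (intro Max_ge) auto
      then show ?thesis unfolding K_def by linarith
    qed
    have "1 - \<epsilon> < measure (M n) {-K<..K}" for n
    proof (cases "n < n0")
      case True
      then show ?thesis
        using Mn.measure_Ioc_gt[OF v(1) Kv] v(2) unfolding \<delta>_def by blast
    next
      case False
      then show ?thesis
        using Mn.measure_Ioc_gt[OF u(1) Ku] n0[of n] unfolding \<delta>_def by simp
    qed
    moreover have "- K < K"
    proof -
      have "0 < 2 / u" using u by simp
      then show ?thesis using Ku by linarith
    qed
    ultimately show "\<exists>a b. a < b \<and> (\<forall>n. 1 - \<epsilon> < measure (M n) {a<..b})" by blast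
  qed
  then obtain r M' where r: "strict_mono (r :: nat \<Rightarrow> nat)" and M': "real_distribution M'"
    and conv: "weak_conv_m (M \<circ> id \<circ> r) M'"
    using tight_imp_convergent_subsubsequence[OF _ strict_mono_id] unfolding id_def by blast
  have char: "char M' = \<phi>"
  proof
    fix t
    have "(\<lambda>n. char ((M \<circ> id \<circ> r) n) t) \<longlonglongrightarrow> char M' t"
      by (rule levy_continuity1[OF _ M' conv]) (simp add: M)
    moreover have "(\<lambda>n. char ((M \<circ> id \<circ> r) n) t) \<longlonglongrightarrow> \<phi> t"
      using LIMSEQ_subseq_LIMSEQ[OF lim r] by (simp add: comp_def)
    ultimately show "char M' t = \<phi> t" by (rule LIMSEQ_unique)
  qed
  have "weak_conv_m M M'"
    using M M' by (rule levy_continuity) (simp add: char lim)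
  with M' char show thesis by (rule that)
qed

text \<open>Bounds on exponential moments pass to the limit as inequalities, which is why
  \<open>laplace_law\<close> asks for no more: exp (- s x) is unbounded, so weak convergence is
  applied to its truncations at K, and then K tends to infinity by monotone convergence.\<close>

lemma laplace_law_LIMSEQ:
  assumes F: "\<And>n. laplace_law (F n)"
    and lim: "\<And>w. 0 \<le> Re w \<Longrightarrow> (\<lambda>n. F n w) \<longlonglongrightarrow> G w"
    and cont: "isCont (\<lambda>t. G (- (\<i> * of_real t))) 0"
  shows "laplace_law G"
proof -
  from F have "\<forall>n. \<exists>M. real_distribution M \<and> (\<forall>t. char M t = F n (- (\<i> * of_real t))) \<and>
     (\<forall>s>0. (\<integral>\<^sup>+x. ennreal (exp (- s * x)) \<partial>M) \<le> ennreal (cmod (F n (of_real s))))"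
    unfolding laplace_law_def by blast
  then obtain M where M: "\<And>n. real_distribution (M n)" "\<And>n t. char (M n) t = F n (- (\<i> * of_real t))"
      "\<And>n s. s > 0 \<Longrightarrow> (\<integral>\<^sup>+x. ennreal (exp (- s * x)) \<partial>M n) \<le> ennreal (cmod (F n (of_real s)))"
    by metis
  obtain M' where M': "real_distribution M'" "char M' = (\<lambda>t. G (- (\<i> * of_real t)))" "weak_conv_m M M'"
  proof (rule levy_continuity_existence[OF M(1) _ cont])
    show "(\<lambda>n. char (M n) t) \<longlonglongrightarrow> G (- (\<i> * of_real t))" for t
      unfolding M(2) by (rule lim) simp
  qed
  interpret Mn: real_distribution "M n" for n by (rule M)
  interpret M': real_distribution M' by (rule M')
  have "(\<integral>\<^sup>+x. ennreal (exp (- s * x)) \<partial>M') \<le> ennreal (cmod (G (of_real s)))" if "s > 0" for s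
  proof -
    let ?f = "\<lambda>K x. min (exp (- s * x)) (real K)"
    have "(\<integral>\<^sup>+x. ennreal (?f K x) \<partial>M') \<le> ennreal (cmod (G (of_real s)))" for K
    proof -
      have int: "integrable N (?f K)" if "real_distribution N" for N
      proof -
        interpret real_distribution N by fact
        show ?thesis by (rule integrable_const_bound[of _ "real K"]) auto
      qed
      have "(\<lambda>n. integral\<^sup>L (M n) (?f K)) \<longlonglongrightarrow> integral\<^sup>L M' (?f K)"
        by (rule weak_conv_imp_integral_bdd_continuous_conv[OF M(1) M'(1) M'(3), where B = "real K"])
           (auto intro!: continuous_intros)
      moreover have "(\<lambda>n. cmod (F n (of_real s))) \<longlonglongrightarrow> cmod (G (of_real s))"
        using that by (intro tendsto_norm lim) simp
      moreover have "integral\<^sup>L (M n) (?f K) \<le> cmod (F n (of_real s))" for n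
      proof -
        have "ennreal (integral\<^sup>L (M n) (?f K)) = (\<integral>\<^sup>+x. ennreal (?f K x) \<partial>M n)"
          by (rule nn_integral_eq_integral[OF int[OF M(1)], symmetric]) simp
        also have "\<dots> \<le> (\<integral>\<^sup>+x. ennreal (exp (- s * x)) \<partial>M n)"
          by (intro nn_integral_mono ennreal_leI) simp
        also have "\<dots> \<le> ennreal (cmod (F n (of_real s)))"
          by (rule M(3)[OF that])
        finally show ?thesis by (simp add: ennreal_le_iff)
      qed
      ultimately have "integral\<^sup>L M' (?f K) \<le> cmod (G (of_real s))"
        by (intro LIMSEQ_le) auto
      then show ?thesis
        by (subst nn_integral_eq_integral[OF int[OF M'(1)]]) (auto intro: ennreal_leI)
    qed
    moreover have "(\<lambda>K. \<integral>\<^sup>+x. ennreal (?f K x) \<partial>M') \<longlonglongrightarrow> (\<integral>\<^sup>+x. ennreal (exp (- s * x)) \<partial>M')"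
    proof (rule nn_integral_LIMSEQ)
      show "incseq (\<lambda>K x. ennreal (?f K x))"
        by (auto simp: incseq_def le_fun_def intro!: ennreal_leI)
      show "(\<lambda>K. ennreal (?f K x)) \<longlonglongrightarrow> ennreal (exp (- s * x))" for x
      proof (rule tendsto_eventually)
        obtain K0 where "exp (- s * x) \<le> real K0" using real_arch_simple by blast
        then show "\<forall>\<^sub>F K in sequentially. ennreal (?f K x) = ennreal (exp (- s * x))"
          by (intro eventually_sequentiallyI[of K0]) (simp add: min_def)
      qed
    qed auto
    ultimately show ?thesis
      by (intro LIMSEQ_le_const2) auto
  qed
  with M' show ?thesis
    unfolding laplace_law_def by auto
qed

section \<open>Lattice compound Poisson laws\<close>

lemma DERIV_difference_quotient_LIMSEQ:
  fixes f :: "complex \<Rightarrow> complex"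
  assumes "(f has_field_derivative D) (at x)"
  shows "(\<lambda>n. of_nat n * (f (x + 1 / of_nat n) - f x)) \<longlonglongrightarrow> D"
proof -
  have "((\<lambda>h. (f (x + h) - f x) / h) \<longlongrightarrow> D) (at 0)"
    using assms by (simp add: DERIV_def)
  moreover have "filterlim (\<lambda>n. 1 / of_nat n :: complex) (at 0) sequentially"
    unfolding filterlim_at
    using lim_1_over_n[where 'a=complex] by (auto simp: eventually_sequentially intro!: exI[of _ 1])
  ultimately have "(\<lambda>n. (f (x + 1 / of_nat n) - f x) / (1 / of_nat n)) \<longlonglongrightarrow> D"
    by (rule filterlim_compose)
  then show ?thesis by (simp add: mult.commute)
qed

text \<open>n Ln (1 + z / n) is a difference quotient of Ln (1 + z h) at h = 0, where the derivative
  is z. Its exponential is the n-th power as soon as 1 + z / n is nonzero, in particular for n >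
  \<bar>z\<bar>.\<close>

lemma complex_exp_limit_sequentially:
  fixes z :: complex
  shows "(\<lambda>n. (1 + z / of_nat n) ^ n) \<longlonglongrightarrow> exp z"
proof -
  have "((\<lambda>h. Ln (1 + z * h)) has_field_derivative z) (at 0)"
    by (auto intro!: derivative_eq_intros)
  from DERIV_difference_quotient_LIMSEQ[OF this]
  have "(\<lambda>n. exp (of_nat n * Ln (1 + z / of_nat n))) \<longlonglongrightarrow> exp z"
    by (intro tendsto_exp) simp
  moreover have "\<forall>\<^sub>F n in sequentially. exp (of_nat n * Ln (1 + z / of_nat n)) = (1 + z / of_nat n) ^ n"
  proof -
    obtain N where N: "cmod z < real N" using reals_Archimedean2 by blast
    have "1 + z / of_nat n \<noteq> 0" if "n \<ge> N" for n
    proof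
      assume 0: "1 + z / of_nat n = 0"
      have "real n > 0" using N that norm_ge_zero[of z] by linarith
      with 0 have "z = - of_nat n"
        by (simp add: field_simps add_eq_0_iff)
      then have "cmod z = real n" by simp
      then show False using N that by simp
    qed
    then show ?thesis
      by (intro eventually_sequentiallyI[of N]) (simp add: exp_of_nat_mult)
  qed
  ultimately show ?thesis by (rule Lim_transform_eventually)
qed

text \<open>The compound Poisson law with jump generating function proportional to \<open>f (r z)\<close>, as the
  limit of \<open>n\<close>-fold sums of laws with generating function \<open>(f (r z) + C) / n\<close>, \<open>C = n - f r\<close>.\<close>

lemma laplace_law_compound_poisson:
  fixes p :: "nat \<Rightarrow> real" and f :: "complex \<Rightarrow> complex"
  assumes p: "\<And>k. 0 \<le> p k" and r: "0 < r" "r < 1"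
    and f: "\<And>z. cmod z < 1 \<Longrightarrow> (\<lambda>k. of_real (p k) * z ^ k) sums f z"
    and cont: "isCont f (of_real r)"
  shows "laplace_law (\<lambda>w. exp (f (of_real r * exp (- w)) - f (of_real r)))"
proof -
  define S where "S = Re (f (of_real r))"
  have "(\<lambda>k. complex_of_real (p k * r ^ k)) sums f (of_real r)"
    using f[of "of_real r"] r by simp
  note fS = sums_of_real_complexD(2)[OF this, folded S_def]
  \<comment> \<open>Starting the number of summands at \<open>Suc N\<close> makes the extra mass
    \<open>C n\<close> at 0 nonnegative and the divisor nonzero.\<close>
  obtain N where N: "S < real N" using reals_Archimedean2 by blast
  define C where "C n = real (n + Suc N) - S" for n
  have C: "C n \<ge> 0" for n using N unfolding C_def by simp
  define G where "G n w = (1 + (f (of_real r * exp (- w)) - f (of_real r)) / of_nat (n + Suc N)) ^ (n + Suc N)" for n w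
  show ?thesis
  proof (rule laplace_law_LIMSEQ)
    show "laplace_law (G n)" for n
    proof -
      define g where "g z = f z + of_real (C n)" for z
      define q where "q k = p k + (if k = 0 then C n else 0)" for k
      have gr: "g (of_real r) = of_nat (n + Suc N)"
        by (simp add: g_def fS C_def)
      have "laplace_law (\<lambda>w. g (of_real r * exp (- w)) / g (of_real r))"
      proof (rule laplace_law_power_series[OF _ r])
        show "0 \<le> q k" for k using p[of k] C by (simp add: q_def)
        show "(\<lambda>k. of_real (q k) * z ^ k) sums g z" if "cmod z < 1" for z
        proof -
          have "(\<lambda>k. of_real (p k) * z ^ k + (if k = 0 then of_real (C n) else 0)) sums (f z + of_real (C n))"
            by (intro sums_add f that sums_single)
          moreover have "(\<lambda>k. of_real (q k) * z ^ k) =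
              (\<lambda>k. of_real (p k) * z ^ k + (if k = 0 then of_real (C n) else 0))"
            by (auto simp: q_def distrib_right)
          ultimately show ?thesis by (simp add: g_def)
        qed
        show "g (of_real r) \<noteq> 0" unfolding gr by (metis Suc_neq_Zero add_Suc_right of_nat_eq_0_iff)
      qed
      then have "laplace_law (\<lambda>w. (g (of_real r * exp (- w)) / g (of_real r)) ^ (n + Suc N))"
        by (rule laplace_law_power)
      moreover have "g (of_real r * exp (- w)) / g (of_real r) =
          1 + (f (of_real r * exp (- w)) - f (of_real r)) / of_nat (n + Suc N)" for w
      proof -
        have "(of_nat (n + Suc N) :: complex) \<noteq> 0"
          by (metis Suc_neq_Zero add_Suc_right of_nat_eq_0_iff)
        moreover have "g (of_real r * exp (- w)) =
            of_nat (n + Suc N) + (f (of_real r * exp (- w)) - f (of_real r))"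
          by (simp add: g_def C_def fS)
        ultimately show ?thesis unfolding gr by (simp add: add_divide_distrib del: of_nat_add of_nat_Suc)
      qed
      ultimately show ?thesis unfolding G_def by simp
    qed
    show "(\<lambda>n. G n w) \<longlonglongrightarrow> exp (f (of_real r * exp (- w)) - f (of_real r))" for w
      unfolding G_def by (rule LIMSEQ_ignore_initial_segment[OF complex_exp_limit_sequentially])
    show "isCont (\<lambda>t. exp (f (of_real r * exp (- (- (\<i> * of_real t)))) - f (of_real r))) 0"
    proof -
      have "isCont (\<lambda>t. f (of_real r * exp (- (- (\<i> * of_real t))))) (0::real)"
        by (rule isCont_o2[of 0 "\<lambda>t::real. of_real r * exp (- (- (\<i> * of_real t)))" f])
           (use cont in \<open>auto intro!: continuous_intros\<close>)
      then show ?thesis by (intro continuous_intros)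
    qed
  qed
qed

section \<open>The binomial series of (1 - z)^\<alpha> and the signs of its coefficients\<close>

text \<open>At k = 2 the signed coefficient is \<alpha> (\<alpha> - 1) / 2, and passing from k to k
  + 1 multiplies it by (k - \<alpha>) / (k + 1), which is nonnegative because \<alpha> < 2 \<le>
  k.\<close>

lemma gbinomial_sign:
  fixes \<alpha> :: real
  assumes "0 < \<alpha>" "\<alpha> < 2" "2 \<le> k"
  shows "0 \<le> sgn (\<alpha> - 1) * ((-1) ^ k * (\<alpha> gchoose k))"
  using \<open>2 \<le> k\<close>
proof (induction k rule: dec_induct)
  case base
  have "0 \<le> sgn (\<alpha> - 1) * (\<alpha> - 1) * \<alpha> / 2"
    using assms by (simp add: sgn_if)
  then show ?case
    by (simp add: gbinomial_prod_rev numeral_2_eq_2 algebra_simps)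
next
  case (step k)
  have "sgn (\<alpha> - 1) * ((-1) ^ Suc k * (\<alpha> gchoose Suc k)) =
      sgn (\<alpha> - 1) * ((-1) ^ k * (\<alpha> gchoose k)) * ((real k - \<alpha>) / real (Suc k))"
  proof -
    have "(\<alpha> gchoose Suc k) = (\<alpha> gchoose k) * (\<alpha> - real k) / real (Suc k)"
      by (simp add: gbinomial_prod_rev)
    also have "\<dots> = - (\<alpha> gchoose k) * ((real k - \<alpha>) / real (Suc k))"
      by (simp add: field_simps)
    finally show ?thesis by simp
  qed
  also have "\<dots> \<ge> 0"
    using step.hyps assms by (intro mult_nonneg_nonneg[OF step.IH] divide_nonneg_nonneg) auto
  finally show ?case .
qed

text \<open>Degrees 0 and 1 are removed from the binomial series because
  \<open>gbinomial_sign\<close> controls the sign from degree 2 on. The removed linear term is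
  compensated later by centring.\<close>

lemma sums_gbinomial_tail:
  fixes \<alpha> :: real and z :: complex
  assumes "cmod z < 1"
  shows "(\<lambda>k. of_real (if k < 2 then 0 else c * ((-1) ^ k * (\<alpha> gchoose k))) * z ^ k) sums
    (of_real c * ((1 - z) powr of_real \<alpha> - 1 + of_real \<alpha> * z))"
proof -
  have of_real: "(of_real \<alpha> gchoose k) = (of_real (\<alpha> gchoose k) :: complex)" for k
    by (simp add: gbinomial_prod_rev)
  have "(\<lambda>k. (of_real \<alpha> gchoose k) * (- z) ^ k) sums (1 + - z) powr of_real \<alpha>"
    using assms by (intro gen_binomial_complex) simp
  moreover have "(\<lambda>k. if k \<in> {0,1} then (of_real \<alpha> gchoose k) * (- z) ^ k else 0) sums
      (\<Sum>k\<in>{0,1}. (of_real \<alpha> gchoose k) * (- z) ^ k)"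
    by (rule sums_If_finite_set) simp
  ultimately have "(\<lambda>k. of_real c * ((of_real \<alpha> gchoose k) * (- z) ^ k -
      (if k \<in> {0,1} then (of_real \<alpha> gchoose k) * (- z) ^ k else 0))) sums
      (of_real c * ((1 + - z) powr of_real \<alpha> - (\<Sum>k\<in>{0,1}. (of_real \<alpha> gchoose k) * (- z) ^ k)))"
    by (intro sums_mult sums_diff)
  moreover have "of_real c * ((of_real \<alpha> gchoose k) * (- z) ^ k -
      (if k \<in> {0,1} then (of_real \<alpha> gchoose k) * (- z) ^ k else 0)) =
      of_real (if k < 2 then 0 else c * ((-1) ^ k * (\<alpha> gchoose k))) * z ^ k" for k
    by (auto simp: of_real power_minus[of z] less_2_cases_iff)
  ultimately show ?thesis by (simp add: algebra_simps)
qed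

section \<open>Totally skewed limit laws\<close>

lemma cmod_exp_minus_1_minus_le: "cmod (exp z - 1 - z) \<le> exp (cmod z) * cmod z ^ 2"
  using Taylor_exp_field[of z 1] by (simp add: numeral_2_eq_2 diff_diff_eq)

text \<open>The remainder is O(h^2) uniformly for h \<le> 1, so after multiplication by h^(-\<beta>)
  it is O(h^(2 - \<beta>)). Applied with \<beta> = \<alpha> to the centring error and with \<beta> =
  1 to the first-order expansion of 1 - r exp (- h w).\<close>

lemma exp_linearisation_LIMSEQ:
  fixes h :: "nat \<Rightarrow> real" and w :: complex
  assumes h: "\<And>n. 0 < h n" "\<And>n. h n \<le> 1" "h \<longlonglongrightarrow> 0" and "\<beta> < 2"
  shows "(\<lambda>n. of_real (h n powr (- \<beta>)) * (exp (of_real (h n) * w) - 1 - of_real (h n) * w)) \<longlonglongrightarrow> 0"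
proof (rule Lim_null_comparison)
  have "cmod (of_real (h n powr (- \<beta>)) * (exp (of_real (h n) * w) - 1 - of_real (h n) * w)) \<le>
      h n powr (2 - \<beta>) * (exp (cmod w) * cmod w ^ 2)" for n
  proof -
    have "cmod (of_real (h n) * w) \<le> cmod w"
      using h(1,2)[of n] by (simp add: norm_mult mult_left_le_one_le)
    then have "cmod (exp (of_real (h n) * w) - 1 - of_real (h n) * w) \<le> exp (cmod w) * cmod (of_real (h n) * w) ^ 2"
      by (intro order_trans[OF cmod_exp_minus_1_minus_le] mult_right_mono) auto
    also have "\<dots> = h n powr 2 * (exp (cmod w) * cmod w ^ 2)"
      using h(1)[of n] by (simp add: norm_mult power_mult_distrib)
    finally have "h n powr (- \<beta>) * cmod (exp (of_real (h n) * w) - 1 - of_real (h n) * w) \<le>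
        h n powr (- \<beta>) * (h n powr 2 * (exp (cmod w) * cmod w ^ 2))"
      by (rule mult_left_mono) simp
    then show ?thesis
      by (simp add: norm_mult powr_add[of _ 2 "- \<beta>", simplified] mult_ac)
  qed
  then show "\<forall>\<^sub>F n in sequentially. norm (of_real (h n powr (- \<beta>)) * (exp (of_real (h n) * w) - 1 - of_real (h n) * w)) \<le>
      h n powr (2 - \<beta>) * (exp (cmod w) * cmod w ^ 2)"
    by simp
  have "(\<lambda>n. h n powr (2 - \<beta>)) \<longlonglongrightarrow> 0"
    using h \<open>\<beta> < 2\<close> by (intro tendsto_zero_powrI[OF _ tendsto_const]) (auto intro!: always_eventually less_imp_le)
  then show "(\<lambda>n. h n powr (2 - \<beta>) * (exp (cmod w) * cmod w ^ 2)) \<longlonglongrightarrow> 0"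
    by (rule tendsto_mult_left_zero)
qed

lemma laplace_law_exp_powr:
  fixes \<alpha> \<kappa> :: real
  assumes \<alpha>: "0 < \<alpha>" "\<alpha> < 2" and "0 \<le> \<kappa>"
  shows "laplace_law (\<lambda>w. exp (of_real (\<kappa> * sgn (\<alpha> - 1)) * w powr of_real \<alpha>))"
proof -
  define \<epsilon> where "\<epsilon> = sgn (\<alpha> - 1)"
  \<comment> \<open>The lattice span; starting at 1/2 keeps it strictly below 1, so that
    \<open>r n\<close> lies strictly between 0 and 1.\<close>
  define h where "h n = 1 / real (n + 2)" for n
  have h: "0 < h n" "h n < 1" for n by (auto simp: h_def)
  have h0: "h \<longlonglongrightarrow> 0"
    unfolding h_def by (rule LIMSEQ_ignore_initial_segment[OF lim_1_over_n])
  \<comment> \<open>The gap 1 - r = h^2 is o(h). Hence 1 - r exp (- h w) behaves like h w, while the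
    constant h^(-\<alpha>) (1 - r)^\<alpha> = h^\<alpha> disappears in the limit.\<close>
  define r where "r n = 1 - (h n)\<^sup>2" for n
  have r: "0 < r n" "r n < 1" for n
    using h[of n] power_strict_mono[of "h n" 1 2] by (auto simp: r_def)
  have r1: "r \<longlonglongrightarrow> 1"
    unfolding r_def using tendsto_diff[OF tendsto_const tendsto_power[OF h0, of 2], of 1] by simp
  define L where "L n = \<kappa> * \<epsilon> * h n powr (- \<alpha>)" for n
  define f where "f n z = of_real (L n) * ((1 - z) powr of_real \<alpha> - 1 + of_real \<alpha> * z)" for n and z :: complex
  \<comment> \<open>The exponent of the rescaled and centred compound Poisson law, up to the factor
    \<kappa> \<epsilon>: the main term, the normalising constant, and what centring leaves of the
    linear term of the series.\<close>
  define T where "T n w = of_real (h n powr (- \<alpha>)) * (1 - of_real (r n) * exp (- (of_real (h n) * w))) powr of_real \<alpha>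
      - of_real (h n powr (- \<alpha>) * (h n)\<^sup>2 powr \<alpha>)
      + of_real (\<alpha> * r n) * (of_real (h n powr (- \<alpha>)) * (exp (of_real (h n) * - w) - 1 - of_real (h n) * - w))"
    for n and w :: complex
  show ?thesis
    unfolding \<epsilon>_def[symmetric]
  proof (rule laplace_law_LIMSEQ)
    show "laplace_law (\<lambda>w. exp (of_real (\<kappa> * \<epsilon>) * T n w))" for n
    proof -
      have "laplace_law (\<lambda>w. exp (f n (of_real (r n) * exp (- w)) - f n (of_real (r n))))"
      proof (rule laplace_law_compound_poisson[OF _ r])
        show "0 \<le> (if k < 2 then 0 else L n * ((-1) ^ k * (\<alpha> gchoose k)))" for k
          using gbinomial_sign[OF \<alpha>, of k] \<open>0 \<le> \<kappa>\<close> h[of n]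
          by (auto simp: L_def \<epsilon>_def mult.assoc mult.left_commute[of _ "h n powr - \<alpha>"])
        show "(\<lambda>k. of_real (if k < 2 then 0 else L n * ((-1) ^ k * (\<alpha> gchoose k))) * z ^ k) sums f n z"
          if "cmod z < 1" for z
          unfolding f_def by (rule sums_gbinomial_tail[OF that])
        have "1 - of_real (r n) \<notin> (\<real>\<^sub>\<le>\<^sub>0 :: complex set)"
          using r[of n] by (auto simp: complex_nonpos_Reals_iff)
        then show "isCont (f n) (of_real (r n))"
          unfolding f_def by (intro continuous_intros) auto
      qed
      from laplace_law_scale[OF this h(1), of n]
      have "laplace_law (\<lambda>w. exp (f n (of_real (r n) * exp (- (of_real (h n) * w))) - f n (of_real (r n))) *
          exp (of_real (L n * \<alpha> * r n * h n) * w))"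
        by (rule laplace_law_mult[OF _ laplace_law_exp])
      moreover have "f n (of_real (r n) * exp (- (of_real (h n) * w))) - f n (of_real (r n)) +
          of_real (L n * \<alpha> * r n * h n) * w = of_real (\<kappa> * \<epsilon>) * T n w" for w
      proof -
        have "(1 - of_real (r n)) powr of_real \<alpha> = (of_real ((h n)\<^sup>2 powr \<alpha>) :: complex)"
          by (simp add: r_def powr_of_real flip: of_real_power)
        then show ?thesis
          by (simp add: f_def T_def L_def algebra_simps)
      qed
      ultimately show ?thesis by (simp flip: exp_add)
    qed
    have T0: "T n 0 = 0" for n
    proof -
      have "(1 - of_real (r n)) powr of_real \<alpha> = (of_real ((h n)\<^sup>2 powr \<alpha>) :: complex)"
        by (simp add: r_def powr_of_real flip: of_real_power)
      then show ?thesis by (simp add: T_def)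
    qed
    show "(\<lambda>n. exp (of_real (\<kappa> * \<epsilon>) * T n w)) \<longlonglongrightarrow> exp (of_real (\<kappa> * \<epsilon>) * w powr of_real \<alpha>)"
      if "0 \<le> Re w" for w
    proof (cases "w = 0")
      case True
      then show ?thesis by (simp add: T0)
    next
      case False
      have w: "w \<notin> \<real>\<^sub>\<le>\<^sub>0" using that False
        by (auto simp: complex_nonpos_Reals_iff complex_eq_iff)
      have "(\<lambda>n. of_real (h n powr (- \<alpha>)) * (1 - of_real (r n) * exp (- (of_real (h n) * w))) powr of_real \<alpha>)
          \<longlonglongrightarrow> w powr of_real \<alpha>"
      proof -
        \<comment> \<open>Since (1 - r) / h = h, the quotient (1 - r exp (- h w)) / h equals r w + h
          minus a linearisation error.\<close>
        have "(\<lambda>n. of_real (r n) * w + of_real (h n) -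
            of_real (r n) * (of_real (h n powr (- 1)) * (exp (of_real (h n) * - w) - 1 - of_real (h n) * - w)))
            \<longlonglongrightarrow> of_real 1 * w + of_real 0 - of_real 1 * 0"
          using h less_imp_le[OF h(2)] by (intro tendsto_intros r1 h0 exp_linearisation_LIMSEQ) auto
        moreover have "of_real (r n) * w + of_real (h n) -
            of_real (r n) * (of_real (h n powr (- 1)) * (exp (of_real (h n) * - w) - 1 - of_real (h n) * - w)) =
            of_real (1 / h n) * (1 - of_real (r n) * exp (- (of_real (h n) * w)))" for n
          using h(1)[of n] by (simp add: r_def powr_minus field_simps power2_eq_square)
        ultimately have "(\<lambda>n. of_real (1 / h n) * (1 - of_real (r n) * exp (- (of_real (h n) * w)))) \<longlonglongrightarrow> w"
          by simp
        then have "(\<lambda>n. (of_real (1 / h n) * (1 - of_real (r n) * exp (- (of_real (h n) * w)))) powr of_real \<alpha>)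
            \<longlonglongrightarrow> w powr of_real \<alpha>"
          by (rule tendsto_powr_complex[OF w _ tendsto_const])
        moreover have "(of_real (1 / h n) * z) powr of_real \<alpha> = of_real (h n powr (- \<alpha>)) * z powr of_real \<alpha>" for n and z :: complex
        proof -
          have "(of_real (1 / h n) * z) powr of_real \<alpha> = of_real (1 / h n) powr of_real \<alpha> * z powr of_real \<alpha>"
            using h(1)[of n] by (intro powr_times_real_left) auto
          moreover have "of_real (1 / h n) powr of_real \<alpha> = (of_real ((1 / h n) powr \<alpha>) :: complex)"
            using h(1)[of n] by (intro powr_of_real) auto
          ultimately show ?thesis
            using h(1)[of n] by (simp add: powr_divide powr_minus_divide)
        qed
        ultimately show ?thesis by simp
      qed
      moreover have "(\<lambda>n. h n powr (- \<alpha>) * (h n)\<^sup>2 powr \<alpha>) \<longlonglongrightarrow> 0"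
      proof -
        have "h n powr (- \<alpha>) * (h n)\<^sup>2 powr \<alpha> = h n powr \<alpha>" for n
          using h(1)[of n] by (simp add: powr_minus powr_mult power2_eq_square)
        then show ?thesis
          using h h0 \<alpha> by (simp, intro tendsto_zero_powrI[OF _ tendsto_const])
            (auto intro!: always_eventually less_imp_le)
      qed
      ultimately have "(\<lambda>n. T n w) \<longlonglongrightarrow> w powr of_real \<alpha> - of_real 0 + of_real (\<alpha> * 1) * 0"
        unfolding T_def using h less_imp_le[OF h(2)] \<alpha>
        by (intro tendsto_intros r1 h0 exp_linearisation_LIMSEQ) auto
      then show ?thesis by (intro tendsto_intros) simp
    qed
    show "isCont (\<lambda>t. exp (of_real (\<kappa> * \<epsilon>) * (- (\<i> * of_real t)) powr of_real \<alpha>)) 0"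
    proof -
      have "((\<lambda>t. (- (\<i> * of_real t)) powr of_real \<alpha>) \<longlongrightarrow> 0) (at (0::real))"
      proof (rule tendsto_norm_zero_cancel)
        have "((\<lambda>t. \<bar>t\<bar> powr \<alpha>) \<longlongrightarrow> 0) (at (0::real))"
          using \<alpha> by (intro tendsto_zero_powrI[OF _ tendsto_const])
            (auto intro!: always_eventually tendsto_rabs_zero tendsto_ident_at)
        then show "((\<lambda>t. cmod ((- (\<i> * of_real t)) powr of_real \<alpha>)) \<longlongrightarrow> 0) (at (0::real))"
          by (simp add: norm_powr_real_powr' norm_mult)
      qed
      then show ?thesis
        using \<alpha> unfolding isCont_def by (auto intro!: tendsto_eq_intros)
    qed
  qed
qed

text \<open>w Ln w is the derivative of a \<mapsto> w^a at a = 1. The difference quotients with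
  increment 1/n are exponents of totally skewed laws of index 1 + 1/n, shifted to account for the
  term - n w.\<close>

lemma laplace_law_exp_xlnx:
  assumes "0 \<le> \<kappa>"
  shows "laplace_law (\<lambda>w. exp (of_real \<kappa> * (w * Ln w)))"
proof (rule laplace_law_LIMSEQ)
  define F where "F n w = exp (of_real \<kappa> * (of_nat n * (w powr (1 + 1 / of_nat n) - w)))" for n and w :: complex
  \<comment> \<open>The offset 2 keeps the index 1 + 1 / (n + 2) below 2.\<close>
  show "laplace_law (F (n + 2))" for n
  proof -
    have "laplace_law (\<lambda>w. exp (of_real (\<kappa> * real (n + 2) * sgn ((1 + 1 / real (n + 2)) - 1)) *
        w powr of_real (1 + 1 / real (n + 2))) * exp (of_real (- (\<kappa> * real (n + 2))) * w))"
      using assms by (intro laplace_law_mult laplace_law_exp_powr laplace_law_exp) (auto intro!: add_pos_nonneg)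
    then show ?thesis
      unfolding F_def by (simp add: algebra_simps flip: exp_add)
  qed
  show "(\<lambda>n. F (n + 2) w) \<longlonglongrightarrow> exp (of_real \<kappa> * (w * Ln w))" for w
  proof (rule LIMSEQ_ignore_initial_segment)
    show "(\<lambda>n. F n w) \<longlonglongrightarrow> exp (of_real \<kappa> * (w * Ln w))"
    proof (cases "w = 0")
      case False
      have "((\<lambda>a. w powr a) has_field_derivative w * Ln w) (at 1)"
        using False by (auto intro!: derivative_eq_intros simp: powr_def)
      from DERIV_difference_quotient_LIMSEQ[OF this] False
      show ?thesis unfolding F_def by (intro tendsto_exp tendsto_mult_left) simp
    qed (simp add: F_def)
  qed
  show "isCont (\<lambda>t. exp (of_real \<kappa> * (- (\<i> * of_real t) * Ln (- (\<i> * of_real t))))) 0"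
  proof -
    have "((\<lambda>t. - (\<i> * of_real t) * Ln (- (\<i> * of_real t))) \<longlongrightarrow> 0) (at (0::real))"
    proof (rule Lim_null_comparison)
      show "((\<lambda>t::real. \<bar>t\<bar> * (\<bar>ln \<bar>t\<bar>\<bar> + pi)) \<longlongrightarrow> 0) (at 0)"
        by real_asymp
      have "cmod (- (\<i> * of_real t) * Ln (- (\<i> * of_real t))) \<le> \<bar>t\<bar> * (\<bar>ln \<bar>t\<bar>\<bar> + pi)" if "t \<noteq> 0" for t
      proof -
        have "cmod (Ln (- (\<i> * of_real t))) \<le> \<bar>ln \<bar>t\<bar>\<bar> + pi"
          using cmod_le[of "Ln (- (\<i> * of_real t))"] that
            mpi_less_Im_Ln[of "- (\<i> * of_real t)"] Im_Ln_le_pi[of "- (\<i> * of_real t)"]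
          by (simp add: Re_Ln norm_mult)
        then show ?thesis by (simp add: norm_mult mult_left_mono)
      qed
      then show "\<forall>\<^sub>F t in at 0. norm (- (\<i> * of_real t) * Ln (- (\<i> * of_real t))) \<le> \<bar>t\<bar> * (\<bar>ln \<bar>t\<bar>\<bar> + pi)"
        by (auto simp: eventually_at intro!: exI[of _ 1])
    qed
    from tendsto_exp[OF tendsto_mult_left[OF this, of "of_real \<kappa>"]] show ?thesis
      unfolding isCont_def by simp
  qed
qed

section \<open>Existence of stable laws\<close>

lemma Ln_minus_ii_times:
  assumes "t \<noteq> 0"
  shows "Ln (- (\<i> * of_real t)) = of_real (ln \<bar>t\<bar>) - \<i> * of_real (pi / 2 * sgn t)"
proof (rule Ln_unique)
  have "exp (- \<i> * of_real (pi / 2 * sgn t)) = - (\<i> * of_real (sgn t))"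
    using assms by (auto simp: sgn_if exp_Euler cis_conv_exp[symmetric] complex_eq_iff Re_exp Im_exp)
  then have "exp (of_real (ln \<bar>t\<bar>) + - \<i> * of_real (pi / 2 * sgn t)) = of_real \<bar>t\<bar> * - (\<i> * of_real (sgn t))"
    unfolding exp_add using assms by (simp add: exp_of_real)
  then have "exp (of_real (ln \<bar>t\<bar>) - \<i> * of_real (pi / 2 * sgn t)) = of_real \<bar>t\<bar> * - (\<i> * of_real (sgn t))"
    by simp
  also have "\<dots> = - (\<i> * of_real t)"
    by (simp add: sgn_if)
  finally show "exp (of_real (ln \<bar>t\<bar>) - \<i> * of_real (pi / 2 * sgn t)) = - (\<i> * of_real t)" .
qed (use pi_gt_zero in \<open>auto simp: sgn_if intro: order_trans[of _ 0]\<close>)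

lemma powr_minus_ii_times:
  "(- (\<i> * of_real t)) powr of_real \<alpha> =
    of_real (\<bar>t\<bar> powr \<alpha>) * (of_real (cos (pi / 2 * \<alpha>)) - \<i> * of_real (sgn t * sin (pi / 2 * \<alpha>)))"
proof (cases "t = 0")
  case False
  then have "(- (\<i> * of_real t)) powr of_real \<alpha> =
      exp (of_real (\<alpha> * ln \<bar>t\<bar>)) * exp (\<i> * of_real (- (sgn t * (pi / 2 * \<alpha>))))"
    by (simp add: powr_def Ln_minus_ii_times algebra_simps flip: exp_add)
  also have "exp (\<i> * of_real (- (sgn t * (pi / 2 * \<alpha>)))) =
      of_real (cos (pi / 2 * \<alpha>)) - \<i> * of_real (sgn t * sin (pi / 2 * \<alpha>))"
    using False by (auto simp: complex_eq_iff Re_exp Im_exp sgn_if)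
  finally show ?thesis
    using False by (simp add: powr_def flip: exp_of_real)
qed simp

text \<open>This is the sign that makes sgn (\<alpha> - 1) w^\<alpha> have negative real part at the
  nonzero points w = - i t of the imaginary axis, where the real part of w^\<alpha> is
  \<bar>t\<bar>^\<alpha> cos (\<pi> \<alpha> / 2).\<close>

lemma sgn_times_cos_half_pi:
  assumes "0 < \<alpha>" "\<alpha> < 2" "\<alpha> \<noteq> 1"
  shows "sgn (\<alpha> - 1) * cos (pi / 2 * \<alpha>) < 0"
proof (cases "\<alpha> < 1")
  case True
  then have "cos (pi / 2 * \<alpha>) > 0"
    using assms by (intro cos_gt_zero) auto
  then show ?thesis using True by simp
next
  case False
  have "sin (pi / 2 * (\<alpha> - 1)) > 0"
    using False assms by (intro sin_gt_zero2) auto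
  moreover have "cos (pi / 2 * \<alpha>) = - sin (pi / 2 * (\<alpha> - 1))"
    unfolding cos_sin_eq sin_minus[symmetric] by (simp add: diff_divide_distrib algebra_simps)
  ultimately show ?thesis using False assms by simp
qed

text \<open>The imaginary axis gives the characteristic function, with skewness 1, and the positive
  axis gives the one-sided exponential moments. The latter serve in
  \<open>skewness_le_1\<close>.\<close>

lemma ex_totally_skewed_law:
  assumes \<alpha>: "0 < \<alpha>" "\<alpha> < 2" and p: "0 \<le> p"
  obtains M where "real_distribution M"
    "\<And>t. char M t = exp (of_real p * stable_psi \<alpha> 1 1 0 t)"
    "\<And>s. 0 < s \<Longrightarrow> (\<integral>\<^sup>+x. ennreal (exp (- s * x)) \<partial>M) < \<infinity>"
proof -
  obtain F where F: "laplace_law F"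
    "\<And>t. F (- (\<i> * of_real t)) = exp (of_real p * stable_psi \<alpha> 1 1 0 t)"
  proof (cases "\<alpha> = 1")
    case True
    \<comment> \<open>On the imaginary axis \<kappa> w Ln w has real part - \<kappa> (\<pi> / 2)
      \<bar>t\<bar>; the choice \<kappa> = 2 p / \<pi> makes this - p \<bar>t\<bar>.\<close>
    have "laplace_law (\<lambda>w. exp (of_real (2 / pi * p) * (w * Ln w)))"
      using p by (intro laplace_law_exp_xlnx) simp
    moreover have "of_real (2 / pi * p) * (- (\<i> * of_real t) * Ln (- (\<i> * of_real t))) =
        of_real p * stable_psi \<alpha> 1 1 0 t" for t
    proof (cases "t = 0")
      case False
      then show ?thesis using True
        by (auto simp: Ln_minus_ii_times stable_psi_def stable_omega_def complex_eq_iff sgn_if field_simps)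
    qed simp
    ultimately show ?thesis
      by (intro that[of "\<lambda>w. exp (of_real (2 / pi * p) * (w * Ln w))"]) (simp_all only:)
  next
    case False
    \<comment> \<open>Division by the absolute value of cos (\<pi> \<alpha> / 2) normalises the real
      part on the imaginary axis to - p \<bar>t\<bar>^\<alpha>.\<close>
    define \<kappa> where "\<kappa> = p / - (sgn (\<alpha> - 1) * cos (pi / 2 * \<alpha>))"
    note neg = sgn_times_cos_half_pi[OF \<alpha> False]
    have "\<kappa> \<ge> 0" unfolding \<kappa>_def using p neg by (intro divide_nonneg_pos) auto
    then have "laplace_law (\<lambda>w. exp (of_real (\<kappa> * sgn (\<alpha> - 1)) * w powr of_real \<alpha>))"
      using \<alpha> by (intro laplace_law_exp_powr)
    moreover have "of_real (\<kappa> * sgn (\<alpha> - 1)) * (- (\<i> * of_real t)) powr of_real \<alpha> =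
        of_real p * stable_psi \<alpha> 1 1 0 t" for t
    proof -
      have cos: "cos (pi / 2 * \<alpha>) \<noteq> 0" and sgn: "sgn (\<alpha> - 1) \<noteq> 0" using neg by auto
      then have "\<kappa> * sgn (\<alpha> - 1) = - (p / cos (pi / 2 * \<alpha>))"
        by (simp add: \<kappa>_def)
      then show ?thesis
        using cos False unfolding powr_minus_ii_times
        by (simp add: stable_psi_def stable_omega_def tan_def complex_eq_iff)
    qed
    ultimately show ?thesis
      by (intro that[of "\<lambda>w. exp (of_real (\<kappa> * sgn (\<alpha> - 1)) * w powr of_real \<alpha>)"]) (simp_all only:)
  qed
  from F(1) obtain M where M: "real_distribution M" "\<And>t. char M t = F (- (\<i> * of_real t))"
      "\<And>s. s > 0 \<Longrightarrow> (\<integral>\<^sup>+x. ennreal (exp (- s * x)) \<partial>M) \<le> ennreal (cmod (F (of_real s)))"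
    unfolding laplace_law_def by metis
  show thesis
  proof (rule that)
    show "(\<integral>\<^sup>+x. ennreal (exp (- s * x)) \<partial>M) < \<infinity>" if "0 < s" for s
      using M(3)[OF that] by (rule le_less_trans) simp
  qed (use M F in auto)
qed

text \<open>Splits the exponent into a totally skewed part and a reflected one. For
  \<bar>\<beta>\<bar> \<le> 1 both weights are nonnegative, which gives existence by convolution;
  for \<beta> > 1 and c > 0 the second weight is negative, which \<open>skewness_le_1\<close>
  exploits.\<close>

lemma stable_psi_decompose:
  assumes "0 \<le> c"
  shows "stable_psi \<alpha> c \<beta> \<mu> t = \<i> * of_real (\<mu> * t) +
    of_real (c powr \<alpha> * (1 + \<beta>) / 2) * stable_psi \<alpha> 1 1 0 t +
    of_real (c powr \<alpha> * (1 - \<beta>) / 2) * stable_psi \<alpha> 1 1 0 (- t)"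
proof -
  have "\<bar>c * t\<bar> powr \<alpha> = c powr \<alpha> * \<bar>t\<bar> powr \<alpha>"
    using assms by (simp add: abs_mult powr_mult)
  then show ?thesis
    by (simp add: stable_psi_def stable_omega_def complex_eq_iff field_simps)
qed

lemma ex_law_stable_psi:
  assumes "0 < \<alpha>" "\<alpha> \<le> 2" "0 \<le> c" "\<bar>\<beta>\<bar> \<le> 1"
  obtains M where "real_distribution M" "\<And>t. char M t = exp (stable_psi \<alpha> c \<beta> \<mu> t)"
proof (cases "\<alpha> = 2")
  case True
  interpret real_distribution std_normal_distribution by (rule real_dist_normal_dist)
  \<comment> \<open>Scaling by sqrt 2 * c turns exp (- t^2 / 2) into exp (- (c t)^2); the skewness
    term vanishes because tan \<pi> = 0.\<close>
  let ?M = "distr std_normal_distribution borel (\<lambda>x. (sqrt 2 * c) * x + \<mu>)"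
  show thesis
  proof (rule that)
    show "real_distribution ?M" by (rule real_distribution_distr) simp
    have "(sqrt 2 * c * t)\<^sup>2 / 2 = \<bar>c * t\<bar> powr 2" for t
      by (cases "c * t = 0") (auto simp: power_mult_distrib powr_realpow)
    then show "char ?M t = exp (stable_psi \<alpha> c \<beta> \<mu> t)" for t
      using True unfolding char_affine[OF real_dist_normal_dist] char_std_normal_distribution
      by (simp add: stable_psi_def stable_omega_def exp_diff exp_minus field_simps flip: exp_of_real)
  qed
next
  case False
  with assms have \<alpha>: "0 < \<alpha>" "\<alpha> < 2" by auto
  have pq: "0 \<le> c powr \<alpha> * (1 + \<beta>) / 2" "0 \<le> c powr \<alpha> * (1 - \<beta>) / 2"
    using assms by auto
  obtain M where M: "real_distribution M"
    "\<And>t. char M t = exp (of_real (c powr \<alpha> * (1 + \<beta>) / 2) * stable_psi \<alpha> 1 1 0 t)"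
    using ex_totally_skewed_law[OF \<alpha> pq(1)] by metis
  obtain N where N: "real_distribution N"
    "\<And>t. char N t = exp (of_real (c powr \<alpha> * (1 - \<beta>) / 2) * stable_psi \<alpha> 1 1 0 t)"
    using ex_totally_skewed_law[OF \<alpha> pq(2)] by metis
  let ?M' = "distr M borel (\<lambda>x. 1 * x + \<mu>)" and ?N' = "distr N borel (\<lambda>x. - 1 * x + 0)"
  interpret M: real_distribution M by fact
  interpret N: real_distribution N by fact
  have M'N': "real_distribution ?M'" "real_distribution ?N'"
    by (intro M.real_distribution_distr N.real_distribution_distr; simp)+
  show thesis
  proof (rule that)
    show "real_distribution (?M' \<star> ?N')"
      using M'N' by (rule real_distribution_convolution)
    show "char (?M' \<star> ?N') t = exp (stable_psi \<alpha> c \<beta> \<mu> t)" for t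
      unfolding char_convolution[OF M'N'] char_affine[OF M(1)] char_affine[OF N(1)] M(2) N(2)
        stable_psi_decompose[OF \<open>0 \<le> c\<close>]
      by (simp add: exp_add)
  qed
qed

section \<open>Stability as a functional equation for the characteristic function\<close>

text \<open>The definition quantifies over independent copies, so the forward direction has to
  produce some, by \<open>ex_indep_copies\<close>. The converse is uniqueness of the law with a
  given characteristic function.\<close>

lemma stable_distribution_iff_char:
  assumes M: "real_distribution M"
  shows "stable_distribution M \<longleftrightarrow>
    (\<forall>n\<ge>1. \<exists>a b. a > 0 \<and> (\<forall>t. char M t ^ n = iexp (b * t) * char M (a * t)))"
proof -
  interpret M: real_distribution M by fact
  have sum: "char (distr P borel (\<lambda>\<omega>. \<Sum>i\<in>{1..n}. X i \<omega>)) t = char M t ^ n"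
    if "prob_space P" "prob_space.indep_vars P (\<lambda>_. borel) X {1..n}" "\<forall>i\<in>{1..n}. distr P borel (X i) = M"
    for P :: "(nat \<Rightarrow> real) measure" and X :: "nat \<Rightarrow> (nat \<Rightarrow> real) \<Rightarrow> real" and n t
    using prob_space.char_distr_sum[OF that(1,2)] that(3) by simp
  show ?thesis
  proof (intro iffI allI impI)
    fix n :: nat assume "stable_distribution M" and n: "n \<ge> 1"
    then obtain a b where ab: "a > 0" "\<And>P X. prob_space P \<Longrightarrow>
        prob_space.indep_vars P (\<lambda>_. borel) X {1..n} \<Longrightarrow> \<forall>i\<in>{1..n}. distr P borel (X i) = M \<Longrightarrow>
        distr P borel (\<lambda>\<omega> :: nat \<Rightarrow> real. \<Sum>i\<in>{1..n}. X i \<omega>) = distr M borel (\<lambda>x. a * x + b)"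
      unfolding stable_distribution_def by metis
    obtain P :: "(nat \<Rightarrow> real) measure" and X where P: "prob_space P"
        "prob_space.indep_vars P (\<lambda>_. borel) X {1..n}" "\<forall>i\<in>{1..n}. distr P borel (X i) = M"
      using ex_indep_copies[OF M n] by blast
    have "char M t ^ n = iexp (b * t) * char M (a * t)" for t
      unfolding sum[OF P, symmetric] ab(2)[OF P] char_affine[OF M] ..
    then show "\<exists>a b. a > 0 \<and> (\<forall>t. char M t ^ n = iexp (b * t) * char M (a * t))"
      using ab(1) by blast
  next
    assume *: "\<forall>n\<ge>1. \<exists>a b. a > 0 \<and> (\<forall>t. char M t ^ n = iexp (b * t) * char M (a * t))"
    show "stable_distribution M"
      unfolding stable_distribution_def
    proof (intro conjI allI impI M)
      fix n :: nat assume "n \<ge> 1"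
      with * obtain a b where ab: "a > 0" "\<And>t. char M t ^ n = iexp (b * t) * char M (a * t)"
        by blast
      have "distr P borel (\<lambda>\<omega>. \<Sum>i\<in>{1..n}. X i \<omega>) = distr M borel (\<lambda>x. a * x + b)"
        if P: "prob_space P" "prob_space.indep_vars P (\<lambda>_. borel) X {1..n}" "\<forall>i\<in>{1..n}. distr P borel (X i) = M"
        for P :: "(nat \<Rightarrow> real) measure" and X
      proof (rule Levy_uniqueness)
        interpret P: prob_space P by fact
        have "X i \<in> borel_measurable P" if "i \<in> {1..n}" for i
          using P(2) that by (auto simp: P.indep_vars_def)
        then show "real_distribution (distr P borel (\<lambda>\<omega>. \<Sum>i\<in>{1..n}. X i \<omega>))"
          by (intro P.real_distribution_distr borel_measurable_sum)
        show "real_distribution (distr M borel (\<lambda>x. a * x + b))"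
          by (rule M.real_distribution_distr) simp
        show "char (distr P borel (\<lambda>\<omega>. \<Sum>i\<in>{1..n}. X i \<omega>)) = char (distr M borel (\<lambda>x. a * x + b))"
          by (rule ext) (simp only: sum[OF P] char_affine[OF M] ab(2))
      qed
      then show "\<exists>a b. a > 0 \<and> (\<forall>(P :: (nat \<Rightarrow> real) measure) X. prob_space P \<longrightarrow>
          prob_space.indep_vars P (\<lambda>_. borel) X {1..n} \<longrightarrow> (\<forall>i\<in>{1..n}. distr P borel (X i) = M) \<longrightarrow>
          distr P borel (\<lambda>\<omega>. \<Sum>i\<in>{1..n}. X i \<omega>) = distr M borel (\<lambda>x. a * x + b))"
        using ab(1) by blast
    qed
  qed
qed

lemma stable_psi_scale:
  assumes "0 < \<alpha>" "0 \<le> c" "n \<ge> (1::nat)"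
  shows "\<exists>a b. a > 0 \<and> (\<forall>t. of_nat n * stable_psi \<alpha> c \<beta> \<mu> t = \<i> * of_real (b * t) + stable_psi \<alpha> c \<beta> \<mu> (a * t))"
proof (cases "\<alpha> = 1")
  case True
  \<comment> \<open>With a = n, the expansion ln \<bar>n t\<bar> = ln n + ln \<bar>t\<bar> produces
    a term linear in t, which is absorbed into b.\<close>
  have "of_nat n * stable_psi \<alpha> c \<beta> \<mu> t =
      \<i> * of_real ((real n * c * \<beta> * (2 / pi) * ln (real n)) * t) + stable_psi \<alpha> c \<beta> \<mu> (real n * t)" for t
  proof (cases "t = 0")
    case False
    then show ?thesis
      using True assms
      by (simp add: stable_psi_def stable_omega_def complex_eq_iff abs_mult ln_mult sgn_mult sgn_if zero_less_mult_iff field_simps)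
  qed simp
  moreover have "real n > 0" using assms by simp
  ultimately show ?thesis by blast
next
  case False
  define a where "a = real n powr (1 / \<alpha>)"
  have a: "a > 0" "a powr \<alpha> = real n"
    using assms by (auto simp: a_def powr_powr)
  have scale: "\<bar>c * (a * t)\<bar> powr \<alpha> = real n * \<bar>c * t\<bar> powr \<alpha>" for t
    using a by (simp add: abs_mult powr_mult)
  have "of_nat n * stable_psi \<alpha> c \<beta> \<mu> t =
      \<i> * of_real ((real n * \<mu> - a * \<mu>) * t) + stable_psi \<alpha> c \<beta> \<mu> (a * t)" for t
    unfolding stable_psi_def scale using False a
    by (simp add: stable_omega_def complex_eq_iff sgn_mult algebra_simps)
  then show ?thesis using a by blast
qed

lemma ex_stable_distribution:
  assumes "0 < \<alpha>" "\<alpha> \<le> 2" "0 \<le> c" "\<bar>\<beta>\<bar> \<le> 1"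
  shows "\<exists>M. stable_distribution M \<and> char M = (\<lambda>t. exp (stable_psi \<alpha> c \<beta> \<mu> t))"
proof -
  obtain M where M: "real_distribution M" "\<And>t. char M t = exp (stable_psi \<alpha> c \<beta> \<mu> t)"
    using ex_law_stable_psi[OF assms] by metis
  have "stable_distribution M"
    unfolding stable_distribution_iff_char[OF M(1)] M(2) exp_of_nat_mult[symmetric] exp_add[symmetric]
    using stable_psi_scale[OF assms(1,3)] by metis
  then show ?thesis using M(2) by blast
qed

section \<open>The functional equation\<close>

text \<open>Density of the positive rationals. Numerator and denominator are at least 2 because the
  scaling relations to which it is applied are taken for n \<ge> 2.\<close>

lemma continuous_zero_on_positive:
  fixes g :: "real \<Rightarrow> real"
  assumes cont: "continuous_on {0<..} g"
    and zero: "\<And>m n :: nat. 2 \<le> m \<Longrightarrow> 2 \<le> n \<Longrightarrow> g (real m / real n) = 0"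
    and "0 < x"
  shows "g x = 0"
proof -
  \<comment> \<open>Adding 2 above and below makes both entries admissible without changing the
    limit x.\<close>
  define q where "q k = (real (nat \<lfloor>real k * x\<rfloor>) + 2) / (real k + 2)" for k
  have "q \<longlonglongrightarrow> x"
  proof (rule tendsto_sandwich)
    show "(\<lambda>k. (real k * x + 1) / (real k + 2)) \<longlonglongrightarrow> x" "(\<lambda>k. (real k * x + 2) / (real k + 2)) \<longlonglongrightarrow> x"
      by real_asymp+
    have "real (nat \<lfloor>real k * x\<rfloor>) \<le> real k * x" "real k * x \<le> real (nat \<lfloor>real k * x\<rfloor>) + 1" for k
      using \<open>0 < x\<close> of_int_floor_le[of "real k * x"] real_of_int_floor_add_one_ge[of "real k * x"]
      by (simp_all add: of_nat_nat)
    then have "(real k * x + 1) / (real k + 2) \<le> q k" "q k \<le> (real k * x + 2) / (real k + 2)" for k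
      unfolding q_def by (intro divide_right_mono; simp add: algebra_simps)+
    then show "\<forall>\<^sub>F k in sequentially. (real k * x + 1) / (real k + 2) \<le> q k"
      "\<forall>\<^sub>F k in sequentially. q k \<le> (real k * x + 2) / (real k + 2)"
      by simp_all
  qed
  moreover have "0 < q k" for k
    unfolding q_def by (intro divide_pos_pos) auto
  ultimately have "(\<lambda>k. g (q k)) \<longlonglongrightarrow> g x"
    using cont \<open>0 < x\<close> by (intro continuous_on_tendsto_compose[of "{0<..}" g]) auto
  moreover have "g (q k) = 0" for k
    using zero[of "nat \<lfloor>real k * x\<rfloor> + 2" "k + 2"] by (simp add: q_def add.commute)
  ultimately show ?thesis
    by (simp add: LIMSEQ_const_iff)
qed

lemma continuous_additive_linear:
  fixes g :: "real \<Rightarrow> real"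
  assumes cont: "continuous_on UNIV g" and add: "\<And>x y. g (x + y) = g x + g y"
  shows "g x = x * g 1"
proof -
  have 0: "g 0 = 0" using add[of 0 0] by simp
  have nat: "g (real n * x) = real n * g x" for n x
    by (induction n) (simp_all add: 0 add distrib_right)
  have pos: "g x = x * g 1" if "0 < x" for x
  proof -
    have "g x - x * g 1 = 0"
    proof (rule continuous_zero_on_positive[OF _ _ that])
      show "continuous_on {0<..} (\<lambda>x. g x - x * g 1)"
        by (intro continuous_intros continuous_on_subset[OF cont]) auto
      show "g (real m / real n) - real m / real n * g 1 = 0" if "2 \<le> m" "2 \<le> n" for m n
        using nat[of m "1 / real n"] nat[of n "1 / real n"] that by (simp add: field_simps)
    qed
    then show ?thesis by simp
  qed
  have "g (- x) = - g x" for x using add[of x "- x"] 0 by simp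
  then show ?thesis
    using pos[of x] pos[of "- x"] 0 by (cases x "0::real" rule: linorder_cases) auto
qed

text \<open>Iteration gives R t0 = q^i R (t0 / s^i). If s \<ge> 1 the arguments stay in a compact
  interval, where R is bounded, and q^i tends to 0; so R t0 would vanish.\<close>

lemma scaling_factor_less_1:
  fixes R :: "real \<Rightarrow> real"
  assumes cont: "continuous_on UNIV R" and R: "\<And>t. R (s * t) = q * R t"
    and "0 < q" "q < 1" "0 < s" and "R t0 \<noteq> 0"
  shows "s < 1"
proof (rule ccontr)
  assume "\<not> s < 1"
  then have s: "1 \<le> s" by simp
  have iter: "R t0 = q ^ i * R (t0 / s ^ i)" for i
  proof (induction i)
    case (Suc i)
    have "R (t0 / s ^ i) = q * R (t0 / s ^ Suc i)"
      using R[of "t0 / s ^ Suc i"] \<open>0 < s\<close> by (simp add: field_simps)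
    with Suc show ?case by simp
  qed simp
  have "bounded (R ` {-\<bar>t0\<bar>..\<bar>t0\<bar>})"
    by (intro compact_imp_bounded compact_continuous_image continuous_on_subset[OF cont]) auto
  then obtain B where "\<forall>y\<in>R ` {-\<bar>t0\<bar>..\<bar>t0\<bar>}. norm y \<le> B"
    unfolding bounded_iff by blast
  then have B: "\<bar>R t\<bar> \<le> B" if "\<bar>t\<bar> \<le> \<bar>t0\<bar>" for t
    using that by (auto simp: abs_le_iff)
  have "\<bar>R t0\<bar> \<le> q ^ i * B" for i
  proof -
    have "1 \<le> s ^ i" using s by (rule one_le_power)
    then have "\<bar>t0 / s ^ i\<bar> \<le> \<bar>t0\<bar>"
      using \<open>0 < s\<close> divide_left_mono[of 1 "s ^ i" "\<bar>t0\<bar>"] by simp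
    then have "\<bar>R (t0 / s ^ i)\<bar> \<le> B" by (rule B)
    then show ?thesis
      using \<open>0 < q\<close> by (subst iter[of i]) (simp add: abs_mult mult_left_mono)
  qed
  moreover have "(\<lambda>i. q ^ i * B) \<longlonglongrightarrow> 0"
    using \<open>0 < q\<close> \<open>q < 1\<close> by (intro tendsto_mult_left_zero LIMSEQ_power_zero) auto
  ultimately have "\<bar>R t0\<bar> \<le> 0"
    by (intro LIMSEQ_le_const) auto
  with \<open>R t0 \<noteq> 0\<close> show False by simp
qed

text \<open>By \<open>scaling_factor_less_1\<close> applied to quotients, m^j < n^k implies (a m)^j
  < (a n)^k. With m or n equal to 2, the ratios ln n / ln 2 and ln (a n) / ln (a 2) then cannot be
  separated by a rational j / k, so they agree.\<close>

lemma scaling_factors_eq_powr: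
  fixes R :: "real \<Rightarrow> real" and a :: "nat \<Rightarrow> real"
  assumes cont: "continuous_on UNIV R" and "R t0 \<noteq> 0"
    and a: "\<And>n. 2 \<le> n \<Longrightarrow> 0 < a n" and R: "\<And>n t. 2 \<le> n \<Longrightarrow> R (a n * t) = real n * R t"
  obtains \<alpha> where "0 < \<alpha>" "\<And>n. 2 \<le> n \<Longrightarrow> a n = real n powr (1 / \<alpha>)"
proof -
  have pow: "R (a n ^ k * t) = real n ^ k * R t" if "2 \<le> n" for n k t
    by (induction k arbitrary: t) (simp_all add: R[OF that] mult.assoc)
  have inv: "R (t / a n ^ k) = R t / real n ^ k" if "2 \<le> n" for n k t
    using pow[OF that, of k "t / a n ^ k"] a[OF that] that by (simp add: field_simps)
  have less: "a m ^ j < a n ^ k" if "2 \<le> m" "2 \<le> n" "real m ^ j < real n ^ k" for m n j k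
  proof -
    have "a m ^ j / a n ^ k < 1"
    proof (rule scaling_factor_less_1[OF cont _ _ _ _ \<open>R t0 \<noteq> 0\<close>])
      show "R (a m ^ j / a n ^ k * t) = real m ^ j / real n ^ k * R t" for t
        using inv[OF that(2), of "a m ^ j * t" k] pow[OF that(1), of j t] by simp
    qed (use a that in auto)
    then show ?thesis using a[OF that(2)] by simp
  qed
  have "1 < a 2"
  proof -
    have "1 / a 2 < 1"
    proof (rule scaling_factor_less_1[OF cont _ _ _ _ \<open>R t0 \<noteq> 0\<close>])
      show "R (1 / a 2 * t) = 1 / 2 * R t" for t
        using inv[of 2 t 1] by simp
    qed (use a in auto)
    then show ?thesis using a[of 2] by simp
  qed
  have eq: "ln (real n) / ln 2 = ln (a n) / ln (a 2)" if n: "2 \<le> n" for n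
  proof (rule ccontr)
    have pos: "0 < ln (real n) / ln 2" using n by simp
    have j: "\<exists>j k :: nat. 0 < k \<and> x < real j / real k \<and> real j / real k < y" if "x < y" "0 < y" for x y :: real
    proof -
      have "max x 0 < y" using that by simp
      from Rats_dense_in_real[OF this] obtain r where r: "r \<in> \<rat>" "max x 0 < r" "r < y"
        by blast
      then obtain j k :: nat where "k \<noteq> 0" "\<bar>r\<bar> = real j / real k"
        using Rats_abs_nat_div_natE[OF r(1)] by metis
      then show ?thesis using r by (intro exI[of _ j] exI[of _ k]) auto
    qed
    have ln_less: "x ^ j < y ^ k \<longleftrightarrow> real j * ln x < real k * ln y" if "0 < x" "0 < y" for x y :: real and j k :: nat
      using ln_less_cancel_iff[of "x ^ j" "y ^ k"] that by (simp add: ln_realpow)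
    assume "ln (real n) / ln 2 \<noteq> ln (a n) / ln (a 2)"
    then consider "ln (real n) / ln 2 < ln (a n) / ln (a 2)" | "ln (a n) / ln (a 2) < ln (real n) / ln 2"
      by linarith
    then show False
    proof cases
      case 1
      then obtain j k :: nat where jk: "0 < k" "ln (real n) / ln 2 < real j / real k" "real j / real k < ln (a n) / ln (a 2)"
        using j[OF 1] pos by auto
      then have "real k * ln (real n) < real j * ln 2" "real j * ln (a 2) < real k * ln (a n)"
        using \<open>1 < a 2\<close> by (simp_all add: field_simps)
      then have "real n ^ k < real 2 ^ j" "a 2 ^ j < a n ^ k"
        using ln_less[of "real n" 2 k j] ln_less[of "a 2" "a n" j k] a[OF n] a[of 2] n by auto
      with less[OF n, of 2 k j] show False by simp
    next
      case 2
      then obtain j k :: nat where jk: "0 < k" "ln (a n) / ln (a 2) < real j / real k" "real j / real k < ln (real n) / ln 2"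
        using j[OF 2] pos by auto
      then have "real j * ln 2 < real k * ln (real n)" "real k * ln (a n) < real j * ln (a 2)"
        using \<open>1 < a 2\<close> by (simp_all add: field_simps)
      then have "real 2 ^ j < real n ^ k" "a n ^ k < a 2 ^ j"
        using ln_less[of 2 "real n" j k] ln_less[of "a n" "a 2" k j] a[OF n] a[of 2] n by auto
      with less[OF _ n, of 2 j k] show False by simp
    qed
  qed
  show thesis
  proof (rule that)
    show "0 < ln 2 / ln (a 2)" using \<open>1 < a 2\<close> by simp
    show "a n = real n powr (1 / (ln 2 / ln (a 2)))" if n: "2 \<le> n" for n
    proof -
      have "ln (a n) = ln (real n) * ln (a 2) / ln 2"
        using eq[OF n] \<open>1 < a 2\<close> by (simp add: field_simps)
      moreover have "a n = exp (ln (a n))" using a[OF n] by simp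
      ultimately show ?thesis using n by (simp add: powr_def mult.commute)
    qed
  qed
qed

text \<open>Dividing the relation for m by the one for n gives scaling by every rational m / n, and
  continuity extends it to all positive reals. The resulting equations in two real variables can
  then be solved explicitly.\<close>

lemma stable_exponent_solution:
  fixes R \<theta> :: "real \<Rightarrow> real"
  assumes contR: "continuous_on UNIV R" and cont\<theta>: "continuous_on UNIV \<theta>" and "R t0 \<noteq> 0"
    and ex: "\<And>n. 2 \<le> n \<Longrightarrow> \<exists>a b. 0 < a \<and> (\<forall>t. real n * R t = R (a * t) \<and> real n * \<theta> t = \<theta> (a * t) + b * t)"
  obtains \<alpha> \<mu> k where "0 < \<alpha>" "\<And>t. 0 < t \<Longrightarrow> R t = R 1 * t powr \<alpha>"
    "\<And>t. 0 < t \<Longrightarrow> \<theta> t = \<mu> * t + k * (if \<alpha> = 1 then t * ln t else t powr \<alpha>)"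
proof -
  from ex obtain a b where a: "\<And>n. 2 \<le> n \<Longrightarrow> 0 < a n"
    and R: "\<And>n t. 2 \<le> n \<Longrightarrow> R (a n * t) = real n * R t"
    and \<theta>: "\<And>n t. 2 \<le> n \<Longrightarrow> \<theta> (a n * t) = real n * \<theta> t - b n * t"
    by (metis add_diff_cancel_right')
  obtain \<alpha> where \<alpha>: "0 < \<alpha>" and an: "\<And>n. 2 \<le> n \<Longrightarrow> a n = real n powr (1 / \<alpha>)"
    using scaling_factors_eq_powr[OF contR \<open>R t0 \<noteq> 0\<close> a R] by metis
  have ratio: "(real m / real n) powr (1 / \<alpha>) = a m / a n" if "2 \<le> m" "2 \<le> n" for m n
    using an that by (simp add: powr_divide)
  have cont: "continuous_on {0<..} (\<lambda>x. f (x powr (1 / \<alpha>) * t))" if "continuous_on UNIV f" for f :: "real \<Rightarrow> real" and t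
    by (rule continuous_on_compose2[OF that]) (auto intro!: continuous_intros)
  have R_powr: "R (x powr (1 / \<alpha>) * t) - x * R t = 0" if "0 < x" for x t
  proof (rule continuous_zero_on_positive[OF _ _ that])
    show "continuous_on {0<..} (\<lambda>x. R (x powr (1 / \<alpha>) * t) - x * R t)"
      by (intro continuous_intros cont contR)
    show "R ((real m / real n) powr (1 / \<alpha>) * t) - real m / real n * R t = 0" if "2 \<le> m" "2 \<le> n" for m n
    proof -
      have "R (a m / a n * t) = real m * R (t / a n)" "R t = real n * R (t / a n)"
        using R[OF that(1), of "t / a n"] R[OF that(2), of "t / a n"] a[OF that(2)] by simp_all
      then show ?thesis using that unfolding ratio[OF that] by simp
    qed
  qed
  \<comment> \<open>The unknown shift contributes a term linear in t, so it is eliminated by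
    subtracting t times the same relation at t = 1.\<close>
  have \<theta>_powr: "x * \<theta> t - \<theta> (x powr (1 / \<alpha>) * t) - t * (x * \<theta> 1 - \<theta> (x powr (1 / \<alpha>) * 1)) = 0" if "0 < x" for x t
  proof (rule continuous_zero_on_positive[OF _ _ that])
    show "continuous_on {0<..} (\<lambda>x. x * \<theta> t - \<theta> (x powr (1 / \<alpha>) * t) - t * (x * \<theta> 1 - \<theta> (x powr (1 / \<alpha>) * 1)))"
      by (intro continuous_intros cont cont\<theta>)
    show "real m / real n * \<theta> t - \<theta> ((real m / real n) powr (1 / \<alpha>) * t) -
        t * (real m / real n * \<theta> 1 - \<theta> ((real m / real n) powr (1 / \<alpha>) * 1)) = 0" if "2 \<le> m" "2 \<le> n" for m n
    proof -
      have *: "\<theta> (a m / a n * t) = real m / real n * \<theta> t + t * ((real m / real n * b n - b m) / a n)" for t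
      proof -
        have "\<theta> t = real n * \<theta> (t / a n) - b n * (t / a n)"
          using \<theta>[OF that(2), of "t / a n"] a[OF that(2)] by simp
        then have "\<theta> (t / a n) = (\<theta> t + b n * (t / a n)) / real n"
          using that by (simp add: field_simps)
        moreover have "\<theta> (a m / a n * t) = real m * \<theta> (t / a n) - b m * (t / a n)"
          using \<theta>[OF that(1), of "t / a n"] by simp
        ultimately have "\<theta> (a m / a n * t) = real m * ((\<theta> t + b n * (t / a n)) / real n) - b m * (t / a n)"
          by simp
        also have "\<dots> = real m / real n * \<theta> t + t * ((real m / real n * b n - b m) / a n)"
          by (simp add: algebra_simps add_divide_distrib diff_divide_distrib)
        finally show ?thesis .
      qed
      show ?thesis
        unfolding ratio[OF that] *[of t] *[of 1] by (simp add: algebra_simps)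
    qed
  qed
  define \<eta> where "\<eta> t = \<theta> t - t * \<theta> 1" for t
  have \<eta>_mult: "\<eta> (s * t) = s powr \<alpha> * \<eta> t + t * \<eta> s" if "0 < s" for s t
    using \<theta>_powr[of "s powr \<alpha>" t] that \<alpha> by (simp add: powr_powr \<eta>_def algebra_simps)
  obtain k where k: "\<And>t. 0 < t \<Longrightarrow> \<eta> t = k * ((if \<alpha> = 1 then t * ln t else t powr \<alpha> - t))"
  proof (cases "\<alpha> = 1")
    case True
    \<comment> \<open>For \<alpha> = 1 the equation for \<eta> (s t) / (s t) becomes additive in
      logarithmic coordinates, that is, Cauchy's equation.\<close>
    define g where "g u = \<eta> (exp u) / exp u" for u
    have "g u = u * g 1" for u
    proof (rule continuous_additive_linear)
      show "continuous_on UNIV g"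
        unfolding g_def \<eta>_def
        by (intro continuous_intros continuous_on_compose2[OF cont\<theta>]) auto
      show "g (x + y) = g x + g y" for x y
        using \<eta>_mult[of "exp x" "exp y"] True by (simp add: g_def exp_add field_simps)
    qed
    then have "\<eta> t / t = ln t * g 1" if "0 < t" for t
      using that unfolding g_def by (metis exp_ln)
    then show ?thesis using True by (intro that[of "g 1"]) (simp add: field_simps)
  next
    case False
    \<comment> \<open>For \<alpha> \<noteq> 1 the two expansions of \<eta> (2 t), obtained by
      exchanging the roles of 2 and t, determine \<eta>.\<close>
    define K where "K = \<eta> 2 / (2 powr \<alpha> - 2)"
    have "2 powr \<alpha> \<noteq> (2::real)" using False powr_inj[of 2 \<alpha> 1] by simp
    then have "\<eta> t = K * (t powr \<alpha> - t)" if "0 < t" for t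
      using \<eta>_mult[of 2 t] \<eta>_mult[of t 2] that by (simp add: K_def field_simps)
    then show ?thesis using False by (intro that[of K]) simp
  qed
  show thesis
  proof (cases "\<alpha> = 1")
    case True
    show ?thesis
    proof (rule that[of \<alpha> "\<theta> 1" k])
      show "R t = R 1 * t powr \<alpha>" if "0 < t" for t
        using R_powr[of t 1] that True by simp
      show "\<theta> t = \<theta> 1 * t + k * (if \<alpha> = 1 then t * ln t else t powr \<alpha>)" if "0 < t" for t
        using k[OF that] True by (simp add: \<eta>_def algebra_simps)
    qed (rule \<alpha>)
  next
    case False
    show ?thesis
    \<comment> \<open>The part - k t of k (t^\<alpha> - t) is moved into the drift.\<close>
    proof (rule that[of \<alpha> "\<theta> 1 - k" k])
      show "R t = R 1 * t powr \<alpha>" if "0 < t" for t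
        using R_powr[of "t powr \<alpha>" 1] that \<alpha> by (simp add: powr_powr)
      show "\<theta> t = (\<theta> 1 - k) * t + k * (if \<alpha> = 1 then t * ln t else t powr \<alpha>)" if "0 < t" for t
        using k[OF that] False by (simp add: \<eta>_def algebra_simps)
    qed (rule \<alpha>)
  qed
qed

section \<open>The exponent of a stable law\<close>

lemma (in real_distribution) char_uminus: "char M (- t) = cnj (char M t)"
proof -
  have "char M (- t) = (CLINT x|M. cnj (iexp (t * x)))"
    unfolding char_def by (simp add: exp_cnj)
  also have "\<dots> = cnj (char M t)"
    unfolding char_def by simp
  finally show ?thesis .
qed

text \<open>If \<open>\<bar>\<phi>(t)\<bar> = 1\<close> then \<open>exp (i t X)\<close> is almost surely the constant \<open>\<phi>(t)\<close>.\<close>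

lemma (in real_distribution) char_add_of_norm_eq_1:
  assumes "cmod (char M t) = 1"
  shows "char M (t + s) = char M t * char M s"
proof -
  let ?u = "char M t"
  have int: "integrable M (\<lambda>x. iexp (t * x))" for t
    by (rule integrable_iexp) auto
  have sq: "(cmod (iexp (t * x) - ?u))\<^sup>2 = 2 - 2 * Re (cnj ?u * iexp (t * x))" for x
  proof -
    have "(cmod (iexp (t * x) - ?u))\<^sup>2 =
        (cmod (iexp (t * x)))\<^sup>2 + (cmod ?u)\<^sup>2 - 2 * Re (cnj ?u * iexp (t * x))"
      unfolding cmod_power2 by (simp add: power2_eq_square algebra_simps)
    then show ?thesis using assms by simp
  qed
  have int_Re: "integrable M (\<lambda>x. Re (cnj ?u * iexp (t * x)))"
    by (intro integrable_Re integrable_mult_right int)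
  have int': "integrable M (\<lambda>x. (cmod (iexp (t * x) - ?u))\<^sup>2)"
    unfolding sq by (intro Bochner_Integration.integrable_diff integrable_mult_right int_Re) auto
  have "(LINT x|M. (cmod (iexp (t * x) - ?u))\<^sup>2) = 2 - 2 * (LINT x|M. Re (cnj ?u * iexp (t * x)))"
    unfolding sq using int_Re
    by (subst Bochner_Integration.integral_diff) (auto simp: prob_space simp del: space_eq_univ times_complex.sel)
  also have "(LINT x|M. Re (cnj ?u * iexp (t * x))) = Re (CLINT x|M. cnj ?u * iexp (t * x))"
    by (intro integral_Re integrable_mult_right int)
  also have "(CLINT x|M. cnj ?u * iexp (t * x)) = cnj ?u * ?u"
    by (simp add: char_def)
  also have "2 - 2 * Re (cnj ?u * ?u) = 0"
    using assms complex_norm_square[of ?u] by (simp add: mult.commute)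
  finally have "AE x in M. (cmod (iexp (t * x) - ?u))\<^sup>2 = 0"
    by (subst (asm) integral_nonneg_eq_0_iff_AE[OF int']) auto
  then have "AE x in M. iexp ((t + s) * x) = ?u * iexp (s * x)"
    by eventually_elim (simp add: distrib_right distrib_left exp_add)
  then have "char M (t + s) = (CLINT x|M. ?u * iexp (s * x))"
    unfolding char_def by (intro integral_cong_AE) auto
  then show ?thesis by (simp add: char_def)
qed

text \<open>The values lie in the discrete set 2 \<pi> i Z, so a continuous function on the line is
  constant. This lifts multiplicative identities between characteristic functions to their
  continuous logarithms.\<close>

lemma continuous_exp_eq_1_imp_zero:
  fixes g :: "real \<Rightarrow> complex"
  assumes cont: "continuous_on UNIV g" and "\<And>t. exp (g t) = 1" and "g 0 = 0"
  shows "g t = 0"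
proof -
  have "g constant_on UNIV"
  proof (rule continuous_discrete_range_constant[OF connected_UNIV cont])
    fix x :: real
    show "\<exists>e>0. \<forall>y. y \<in> UNIV \<and> g y \<noteq> g x \<longrightarrow> e \<le> norm (g y - g x)"
    proof (intro exI[of _ 1] conjI allI impI)
      fix y assume "y \<in> UNIV \<and> g y \<noteq> g x"
      moreover have "exp (g y - g x) = 1" using assms(2) by (simp add: exp_diff)
      then obtain n :: int where n: "Re (g y - g x) = 0" "Im (g y - g x) = of_int (2 * n) * pi"
        unfolding exp_eq_1 by blast
      ultimately have "n \<noteq> 0" by (auto simp: complex_eq_iff)
      then have "1 \<le> \<bar>of_int n :: real\<bar>" by simp
      then have "1 * 1 \<le> \<bar>of_int (2 * n)\<bar> * pi"
        using pi_gt3 by (intro mult_mono) auto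
      also have "\<dots> = \<bar>Im (g y - g x)\<bar>" using n pi_gt_zero by (simp add: abs_mult)
      also have "\<dots> \<le> norm (g y - g x)" by (rule abs_Im_le_cmod)
      finally show "1 \<le> norm (g y - g x)" by simp
    qed simp
  qed
  then show ?thesis using \<open>g 0 = 0\<close> unfolding constant_on_def by (metis UNIV_I)
qed

text \<open>A zero t propagates to all t a^i if a < 1, or to all t / a^i if a > 1, and these
  accumulate at 0, where the value is 1. If a = 1 the modulus takes only the values 0 and 1, so by
  the intermediate value theorem it cannot descend from 1 to 0.\<close>

lemma (in real_distribution) char_nonzero_of_scaling:
  assumes "a > 0" and scale: "\<And>t. cmod (char M t) ^ 2 = cmod (char M (a * t))"
  shows "char M t \<noteq> 0"
proof
  assume zero: "char M t = 0"
  have cont: "isCont (\<lambda>t. cmod (char M t)) x" for x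
    by (intro continuous_norm isCont_char)
  have no_zeros: False if "\<And>i. char M (t * c ^ i) = 0" "\<bar>c\<bar> < 1" for c
  proof -
    have "(\<lambda>i. t * c ^ i) \<longlonglongrightarrow> t * 0"
      using that(2) by (intro tendsto_mult_left LIMSEQ_power_zero) auto
    then have "(\<lambda>i. char M (t * c ^ i)) \<longlonglongrightarrow> char M 0"
      using isCont_tendsto_compose[OF isCont_char[of 0]] by simp
    then show False by (simp add: that(1) char_zero LIMSEQ_const_iff)
  qed
  consider "a < 1" | "a = 1" | "1 < a" by linarith
  then show False
  proof cases
    case 1
    have "char M (t * a ^ i) = 0" for i
    proof (induction i)
      case (Suc i)
      then show ?case using scale[of "t * a ^ i"] by (simp add: mult_ac)
    qed (simp add: zero)
    then show ?thesis using no_zeros[of a] 1 \<open>a > 0\<close> by simp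
  next
    case 2
    have "\<exists>x. min 0 t \<le> x \<and> x \<le> max 0 t \<and> cmod (char M x) = 1 / 2"
    proof (cases "0 \<le> t")
      case True
      then show ?thesis
        using IVT2'[of "\<lambda>t. cmod (char M t)" t "1 / 2" 0] cont
        by (auto simp: zero char_zero intro: continuous_at_imp_continuous_on)
    next
      case False
      then show ?thesis
        using IVT'[of "\<lambda>t. cmod (char M t)" t "1 / 2" 0] cont
        by (auto simp: zero char_zero intro: continuous_at_imp_continuous_on)
    qed
    then obtain x where "cmod (char M x) = 1 / 2" by blast
    then show ?thesis using scale[of x] 2 by (simp add: power2_eq_square)
  next
    case 3
    have "char M (t * (1 / a) ^ i) = 0" for i
    proof (induction i)
      case (Suc i)
      have "cmod (char M (t * (1 / a) ^ Suc i)) ^ 2 = cmod (char M (t * (1 / a) ^ i))"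
        using scale[of "t * (1 / a) ^ Suc i"] \<open>a > 0\<close> by simp
      with Suc show ?case by simp
    qed (simp add: zero)
    then show ?thesis using no_zeros[of "1 / a"] 3 by simp
  qed
qed

text \<open>The first alternative is modulus 1 everywhere, the point masses, for which stability
  does not determine the scaling factors. Otherwise R is somewhere nonzero and
  \<open>stable_exponent_solution\<close> applies. Negative arguments are left to conjugation
  symmetry.\<close>

theorem stable_distribution_char_form:
  assumes "stable_distribution M"
  obtains \<mu> where "\<And>t. char M t = iexp (\<mu> * t)"
  | \<alpha> C \<mu> k where "0 < \<alpha>" "0 < C"
    "\<And>t. 0 < t \<Longrightarrow> char M t = exp (\<i> * of_real (\<mu> * t) - of_real (C * t powr \<alpha>) +
       \<i> * of_real (k * (if \<alpha> = 1 then t * ln t else t powr \<alpha>)))"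
proof -
  have M: "real_distribution M" using assms by (simp add: stable_distribution_def)
  interpret real_distribution M by (rule M)
  have ex: "\<exists>a b. a > 0 \<and> (\<forall>t. char M t ^ n = iexp (b * t) * char M (a * t))" if "2 \<le> n" for n
    using assms[unfolded stable_distribution_iff_char[OF M]] that by simp
  have nz: "char M t \<noteq> 0" for t
  proof -
    obtain a b where ab: "a > 0" "\<And>t. char M t ^ 2 = iexp (b * t) * char M (a * t)"
      using ex[of 2] by auto
    have "cmod (char M t) ^ 2 = cmod (char M (a * t))" for t
      using arg_cong[OF ab(2)[of t], of cmod] by (simp add: norm_power norm_mult)
    then show ?thesis using ab(1) by (intro char_nonzero_of_scaling)
  qed
  have "continuous_on UNIV (char M)"
    by (intro continuous_at_imp_continuous_on ballI isCont_char)
  then obtain g where g: "continuous_on UNIV g" "\<And>t. char M t = exp (g t)"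
    using continuous_logarithm_on_contractible[of UNIV "char M"] nz convex_imp_contractible[OF convex_UNIV]
    by (metis UNIV_I)
  define \<psi> where "\<psi> t = g t - g 0" for t
  have cont: "continuous_on UNIV \<psi>"
    unfolding \<psi>_def by (intro continuous_intros g)
  have \<psi>0: "\<psi> 0 = 0" by (simp add: \<psi>_def)
  have char: "char M t = exp (\<psi> t)" for t
    using g(2)[of t] g(2)[of 0] by (simp add: \<psi>_def exp_diff char_zero)
  define R where "R t = - Re (\<psi> t)" for t
  define \<theta> where "\<theta> t = Im (\<psi> t)" for t
  have \<psi>: "\<psi> t = - of_real (R t) + \<i> * of_real (\<theta> t)" for t
    by (simp add: complex_eq_iff R_def \<theta>_def)
  have contR: "continuous_on UNIV R" and cont\<theta>: "continuous_on UNIV \<theta>"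
    unfolding R_def \<theta>_def by (intro continuous_intros cont)+
  have normR: "cmod (char M t) = exp (- R t)" for t
    unfolding char norm_exp_eq_Re R_def by simp
  show thesis
  proof (cases "\<forall>t. R t = 0")
    case True
    have "\<theta> (t + s) = \<theta> t + \<theta> s" for t s
    proof -
      have "\<psi> (t + s) - \<psi> t - \<psi> s = 0"
      proof (rule continuous_exp_eq_1_imp_zero[where g = "\<lambda>s. \<psi> (t + s) - \<psi> t - \<psi> s"])
        show "continuous_on UNIV (\<lambda>s. \<psi> (t + s) - \<psi> t - \<psi> s)"
          by (intro continuous_intros cont continuous_on_compose2[OF cont]) auto
        show "exp (\<psi> (t + s) - \<psi> t - \<psi> s) = 1" for s
          using char_add_of_norm_eq_1[of t s] normR[of t] True nz by (simp add: exp_diff flip: char)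
      qed (simp add: \<psi>0)
      then show ?thesis by (simp add: \<theta>_def complex_eq_iff)
    qed
    then have "\<theta> t = t * \<theta> 1" for t
      by (rule continuous_additive_linear[OF cont\<theta>])
    then have "char M t = iexp (\<theta> 1 * t)" for t
      using True unfolding char \<psi> by (metis add_0 minus_zero mult.commute of_real_0)
    then show thesis by (rule that(1))
  next
    case False
    then obtain t0 where t0: "R t0 \<noteq> 0" by blast
    have "\<exists>a b. 0 < a \<and> (\<forall>t. real n * R t = R (a * t) \<and> real n * \<theta> t = \<theta> (a * t) + b * t)" if n: "2 \<le> n" for n
    proof -
      obtain a b where ab: "a > 0" "\<And>t. char M t ^ n = iexp (b * t) * char M (a * t)"
        using ex[OF n] by blast
      have "of_nat n * \<psi> t - \<i> * of_real (b * t) - \<psi> (a * t) = 0" for t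
      proof (rule continuous_exp_eq_1_imp_zero[where g = "\<lambda>t. of_nat n * \<psi> t - \<i> * of_real (b * t) - \<psi> (a * t)"])
        show "continuous_on UNIV (\<lambda>t. of_nat n * \<psi> t - \<i> * of_real (b * t) - \<psi> (a * t))"
          by (intro continuous_intros cont continuous_on_compose2[OF cont]) auto
        show "exp (of_nat n * \<psi> t - \<i> * of_real (b * t) - \<psi> (a * t)) = 1" for t
          using ab(2)[of t] unfolding char by (simp add: exp_diff exp_of_nat_mult)
      qed (simp add: \<psi>0)
      then have "real n * R t = R (a * t) \<and> real n * \<theta> t = \<theta> (a * t) + b * t" for t
        by (simp add: R_def \<theta>_def complex_eq_iff algebra_simps)
      then show ?thesis using ab(1) by blast
    qed
    then obtain \<alpha> \<mu> k where sol: "0 < \<alpha>" "\<And>t. 0 < t \<Longrightarrow> R t = R 1 * t powr \<alpha>"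
      "\<And>t. 0 < t \<Longrightarrow> \<theta> t = \<mu> * t + k * (if \<alpha> = 1 then t * ln t else t powr \<alpha>)"
      using stable_exponent_solution[OF contR cont\<theta> t0] by metis
    \<comment> \<open>Evenness moves the point where R is nonzero to the positive half line, where
      the solution formula holds.\<close>
    have "R \<bar>t\<bar> = R t" for t
    proof (cases "t < 0")
      case True
      have "exp (- R (- t)) = exp (- R t)"
        unfolding normR[symmetric] char_uminus by simp
      with True show ?thesis by simp
    qed simp
    moreover have "t0 \<noteq> 0" using t0 \<psi>0 by (auto simp: R_def)
    ultimately have "R 1 \<noteq> 0"
      using sol(2)[of "\<bar>t0\<bar>"] t0 by auto
    moreover have "0 \<le> R 1"
      using cmod_char_le_1[of 1] unfolding normR by simp
    ultimately have "0 < R 1" by simp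
    then show thesis
    proof (rule that(2)[OF sol(1)])
      show "char M t = exp (\<i> * of_real (\<mu> * t) - of_real (R 1 * t powr \<alpha>) +
         \<i> * of_real (k * (if \<alpha> = 1 then t * ln t else t powr \<alpha>)))" if "0 < t" for t
        unfolding char \<psi> sol(2)[OF that] sol(3)[OF that] by (simp add: algebra_simps)
    qed
  qed
qed

section \<open>Restrictions on the parameters\<close>

text \<open>Fatou's lemma for 2 n^2 (1 - cos (x / n)), which tends to x^2 and whose integral is 2
  n^2 (1 - Re \<phi>(1/n)).\<close>

lemma (in real_distribution) second_moment_le:
  assumes "0 \<le> C" and bound: "\<forall>\<^sub>F t in at_right 0. 1 - Re (char M t) \<le> C * t\<^sup>2"
  shows "(\<integral>\<^sup>+x. ennreal (x\<^sup>2) \<partial>M) \<le> ennreal (2 * C)"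
proof -
  define f where "f n x = 2 * (real (Suc n))\<^sup>2 * (1 - cos (1 / real (Suc n) * x))" for n x
  have nonneg: "0 \<le> f n x" for n x by (simp add: f_def)
  have int: "integrable M (f n)" for n
    unfolding f_def by (intro integrable_mult_right Bochner_Integration.integrable_diff integrable_cos) auto
  have "(\<integral>\<^sup>+x. liminf (\<lambda>n. ennreal (f n x)) \<partial>M) \<le> liminf (\<lambda>n. \<integral>\<^sup>+x. ennreal (f n x) \<partial>M)"
    by (rule nn_integral_liminf) (simp add: f_def)
  also have "liminf (\<lambda>n. \<integral>\<^sup>+x. ennreal (f n x) \<partial>M) \<le> ennreal (2 * C)"
  proof (rule Liminf_le)
    have "filterlim (\<lambda>n. 1 / real (Suc n)) (at_right 0) sequentially"
      by real_asymp
    from eventually_compose_filterlim[OF bound this]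
    show "\<forall>\<^sub>F n in sequentially. (\<integral>\<^sup>+x. ennreal (f n x) \<partial>M) \<le> ennreal (2 * C)"
    proof eventually_elim
      case (elim n)
      have "(\<integral>\<^sup>+x. ennreal (f n x) \<partial>M) = ennreal (integral\<^sup>L M (f n))"
        using nonneg by (intro nn_integral_eq_integral int) auto
      also have "integral\<^sup>L M (f n) = 2 * (real (Suc n))\<^sup>2 * (1 - Re (char M (1 / real (Suc n))))"
      proof -
        have "(LINT x|M. 1 - cos (1 / real (Suc n) * x)) = 1 - Re (char M (1 / real (Suc n)))"
          unfolding Re_char
          by (subst Bochner_Integration.integral_diff[OF _ integrable_cos])
             (simp_all add: prob_space del: space_eq_univ)
        then show ?thesis unfolding f_def integral_mult_right_zero by simp
      qed
      also have "\<dots> \<le> 2 * (real (Suc n))\<^sup>2 * (C * (1 / real (Suc n))\<^sup>2)"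
        using elim by (intro mult_left_mono) auto
      also have "\<dots> = 2 * C"
        by (simp add: power_divide del: of_nat_Suc)
      finally show ?case by (simp add: ennreal_leI)
    qed
  qed simp
  finally have "(\<integral>\<^sup>+x. liminf (\<lambda>n. ennreal (f n x)) \<partial>M) \<le> ennreal (2 * C)" .
  moreover have "liminf (\<lambda>n. ennreal (f n x)) = ennreal (x\<^sup>2)" for x
  proof (rule lim_imp_Liminf)
    have "(\<lambda>n. f n x) \<longlonglongrightarrow> x * x"
      unfolding f_def by real_asymp
    then have "(\<lambda>n. f n x) \<longlonglongrightarrow> x\<^sup>2"
      by (simp add: power2_eq_square)
    then show "(\<lambda>n. ennreal (f n x)) \<longlonglongrightarrow> ennreal (x\<^sup>2)"
      by (rule tendsto_ennrealI)
  qed simp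
  ultimately show ?thesis by simp
qed

lemma (in real_distribution) one_minus_Re_char_le:
  assumes "integrable M (\<lambda>x. x\<^sup>2)"
  shows "1 - Re (char M t) \<le> t\<^sup>2 / 2 * (LINT x|M. x\<^sup>2)"
proof -
  have "1 - Re (char M t) = (LINT x|M. 1 - cos (t * x))"
    using integrable_cos[of t] by (simp add: Re_char prob_space del: space_eq_univ)
  also have "\<dots> \<le> (LINT x|M. t\<^sup>2 / 2 * x\<^sup>2)"
  proof (rule integral_mono)
    show "1 - cos (t * x) \<le> t\<^sup>2 / 2 * x\<^sup>2" for x
    proof -
      have "1 - cos (t * x) = 2 * (sin (t * x / 2))\<^sup>2"
        using cos_double_sin[of "t * x / 2"] by simp
      also have "(sin (t * x / 2))\<^sup>2 \<le> (t * x / 2)\<^sup>2"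
        using abs_sin_x_le_abs_x[of "t * x / 2"] by (simp flip: abs_le_square_iff)
      finally show ?thesis by (simp add: power2_eq_square)
    qed
  qed (use assms integrable_cos[of t] in auto)
  finally show ?thesis by simp
qed

lemma (in real_distribution) integrable_square_of_nn_integral:
  assumes "(\<integral>\<^sup>+x. ennreal (x\<^sup>2) \<partial>M) < \<infinity>"
  shows "integrable M (\<lambda>x::real. x\<^sup>2)"
  by (intro integrableI_nonneg assms) simp_all

lemma abs_sin_minus_self_le: "\<bar>sin y - y\<bar> \<le> y\<^sup>2" for y :: real
proof -
  have "\<bar>sin y - y\<bar> = \<bar>Im (iexp y - (\<Sum>k\<le>1. (\<i> * y) ^ k / fact k))\<bar>"
    by (simp add: Im_exp)
  also have "\<dots> \<le> \<bar>y\<bar> ^ Suc 1 / fact (Suc 1)"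
    by (rule order_trans[OF abs_Im_le_cmod iexp_approx1])
  also have "\<dots> = y\<^sup>2 / 2"
    by (simp add: power2_eq_square)
  also have "\<dots> \<le> y\<^sup>2" by simp
  finally show ?thesis .
qed

text \<open>The bound 1 - Re \<phi>(t) = O(t^2) gives a finite second moment. For \<alpha> > 2 it is
  o(t^2), so the second moment is 0, contradicting \<bar>\<phi>(1)\<bar> = exp (- C) < 1. For
  \<alpha> = 2 the imaginary part is m t + o(t^2) with m the mean, and also k t^2 + o(t^2), which
  forces m = k = 0.\<close>

lemma (in real_distribution) index_le_2:
  assumes \<alpha>: "2 \<le> \<alpha>" and "0 < C"
    and char: "\<And>t. 0 < t \<Longrightarrow> char M t = exp (of_real (t powr \<alpha>) * (- of_real C + \<i> * of_real k))"
  shows "\<alpha> = 2 \<and> k = 0"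
proof -
  let ?z = "- of_real C + \<i> * of_real k :: complex"
  have near: "1 - Re (char M t) \<le> exp (cmod ?z) * cmod ?z * t powr \<alpha>" if "0 < t" "t < 1" for t
  proof -
    have t: "t powr \<alpha> \<le> 1" using that \<alpha> by (intro powr_le1) auto
    have "1 - Re (char M t) \<le> cmod (1 - char M t)"
      using complex_Re_le_cmod[of "1 - char M t"] by simp
    also have "\<dots> \<le> exp (cmod (of_real (t powr \<alpha>) * ?z)) * cmod (of_real (t powr \<alpha>) * ?z)"
      using Taylor_exp_field[of "of_real (t powr \<alpha>) * ?z" 0] char[OF \<open>0 < t\<close>] by (simp add: norm_minus_commute)
    also have "\<dots> \<le> exp (cmod ?z) * cmod (of_real (t powr \<alpha>) * ?z)"
      using t by (intro mult_right_mono) (auto simp: norm_mult mult_left_le_one_le)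
    finally show ?thesis by (simp add: norm_mult mult_ac)
  qed
  have lim1: "\<forall>\<^sub>F t in at_right (0::real). 0 < t \<and> t < 1"
    using eventually_at_right_real[of 0 "1::real"] by (auto elim: eventually_mono)
  have "(\<integral>\<^sup>+x. ennreal (x\<^sup>2) \<partial>M) \<le> ennreal (2 * (exp (cmod ?z) * cmod ?z))"
  proof (rule second_moment_le)
    show "\<forall>\<^sub>F t in at_right 0. 1 - Re (char M t) \<le> exp (cmod ?z) * cmod ?z * t\<^sup>2"
      using lim1
    proof eventually_elim
      case (elim t)
      have "t powr \<alpha> \<le> t powr 2" using elim \<alpha> by (intro powr_mono') auto
      then have "exp (cmod ?z) * cmod ?z * t powr \<alpha> \<le> exp (cmod ?z) * cmod ?z * t\<^sup>2"
        using elim by (intro mult_left_mono) auto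
      with near[of t] elim show ?case by linarith
    qed
  qed simp
  then have int: "integrable M (\<lambda>x. x\<^sup>2)"
    by (intro integrable_square_of_nn_integral) (auto simp: le_less_trans)
  have "\<alpha> = 2"
  proof (rule ccontr)
    assume "\<alpha> \<noteq> 2"
    with \<alpha> have "2 < \<alpha>" by simp
    have small: "(\<integral>\<^sup>+x. ennreal (x\<^sup>2) \<partial>M) \<le> ennreal (2 * C')" if "0 < C'" for C'
    proof (rule second_moment_le)
      have "((\<lambda>t. exp (cmod ?z) * cmod ?z * t powr (\<alpha> - 2)) \<longlongrightarrow> 0) (at_right 0)"
        using \<open>2 < \<alpha>\<close> by real_asymp
      from order_tendstoD(2)[OF this \<open>0 < C'\<close>] lim1
      show "\<forall>\<^sub>F t in at_right 0. 1 - Re (char M t) \<le> C' * t\<^sup>2"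
      proof eventually_elim
        case (elim t)
        have "exp (cmod ?z) * cmod ?z * t powr \<alpha> = exp (cmod ?z) * cmod ?z * t powr (\<alpha> - 2) * t\<^sup>2"
          using elim by (simp add: powr_diff)
        also have "\<dots> \<le> C' * t\<^sup>2" using elim by (intro mult_right_mono) auto
        finally show ?case using near[of t] elim by linarith
      qed
    qed (use that in simp)
    have "(\<integral>\<^sup>+x. ennreal (x\<^sup>2) \<partial>M) = ennreal (LINT x|M. x\<^sup>2)"
      by (intro nn_integral_eq_integral int) auto
    with small have small': "(LINT x|M. x\<^sup>2) \<le> 2 * C'" if "0 < C'" for C'
      using small[OF that] that by (simp add: ennreal_le_iff)
    have "(LINT x|M. x\<^sup>2) \<le> 0"
    proof (rule field_le_epsilon)
      show "(LINT x|M. x\<^sup>2) \<le> 0 + e" if "0 < e" for e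
        using small'[of "e / 2"] that by simp
    qed
    then have "1 - Re (char M 1) \<le> 0"
      using one_minus_Re_char_le[OF int, of 1] by simp
    moreover have "Re (char M 1) \<le> exp (- C)"
      using complex_Re_le_cmod[of "char M 1"] char[of 1] by (simp add: norm_exp_eq_Re)
    ultimately show False using \<open>0 < C\<close> exp_less_one_iff[of "- C"] by linarith
  qed
  have intx: "integrable M (\<lambda>x. x)"
    using int by (rule square_integrable_imp_integrable[rotated]) simp
  define m where "m = (LINT x|M. x)"
  have Im: "Im (char M t) = (LINT x|M. sin (t * x))" for t
  proof -
    have "Im (char M t) = (LINT x|M. Im (iexp (t * x)))"
      unfolding char_def by (rule integral_Im[symmetric]) (auto intro!: integrable_iexp)
    then show ?thesis by (simp add: Im_exp)
  qed
  have ints: "integrable M (\<lambda>x. sin (t * x))" for t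
    by (rule integrable_const_bound[of _ 1]) auto
  \<comment> \<open>The error of sin (t x) against t x at t = 1 / (n + 1), multiplied by (n + 1)^2:
    it tends to 0 pointwise and is dominated by x^2.\<close>
  let ?g = "\<lambda>n x. (real (Suc n))\<^sup>2 * (sin (1 / real (Suc n) * x) - 1 / real (Suc n) * x)"
  have "(\<lambda>n. LINT x|M. ?g n x) \<longlonglongrightarrow> (LINT x|M. 0)"
  proof (rule integral_dominated_convergence[where w = "\<lambda>x. x\<^sup>2"])
    show "AE x in M. (\<lambda>n. ?g n x) \<longlonglongrightarrow> 0"
      by (rule AE_I2) real_asymp
    have "\<bar>?g n x\<bar> \<le> x\<^sup>2" for n x
    proof -
      let ?y = "1 / real (Suc n) * x"
      have "(real (Suc n))\<^sup>2 * \<bar>sin ?y - ?y\<bar> \<le> (real (Suc n))\<^sup>2 * ?y\<^sup>2"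
        by (intro mult_left_mono abs_sin_minus_self_le) simp
      then show ?thesis by (simp add: abs_mult power_divide power_mult_distrib del: of_nat_Suc)
    qed
    then show "AE x in M. norm (?g n x) \<le> x\<^sup>2" for n by simp
  qed (use int in auto)
  moreover have "(LINT x|M. ?g n x) =
      (real (Suc n))\<^sup>2 * (exp (- C / (real (Suc n))\<^sup>2) * sin (k / (real (Suc n))\<^sup>2)) - real (Suc n) * m" for n
  proof -
    have "(LINT x|M. ?g n x) = (real (Suc n))\<^sup>2 * (Im (char M (1 / real (Suc n))) - 1 / real (Suc n) * m)"
      using ints[of "1 / real (Suc n)"] intx by (simp add: Im m_def)
    also have "Im (char M (1 / real (Suc n))) = exp (- C / (real (Suc n))\<^sup>2) * sin (k / (real (Suc n))\<^sup>2)"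
      using \<open>\<alpha> = 2\<close> by (subst char) (simp_all add: Im_exp powr_divide del: of_nat_Suc)
    finally show ?thesis by (simp add: algebra_simps power2_eq_square del: of_nat_Suc)
  qed
  ultimately have "(\<lambda>n. (real (Suc n))\<^sup>2 * (exp (- C / (real (Suc n))\<^sup>2) * sin (k / (real (Suc n))\<^sup>2)) -
      real (Suc n) * m) \<longlonglongrightarrow> 0"
    by simp
  moreover have "(\<lambda>n. (real (Suc n))\<^sup>2 * (exp (- C / (real (Suc n))\<^sup>2) * sin (k / (real (Suc n))\<^sup>2))) \<longlonglongrightarrow> k"
    by real_asymp
  \<comment> \<open>Convergence of (n + 1) m forces m = 0, and then the limit k is 0 as
    well.\<close>
  ultimately have lim: "(\<lambda>n. real (Suc n) * m) \<longlonglongrightarrow> k"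
    using tendsto_diff[of _ k sequentially _ 0] by fastforce
  have "(\<lambda>n. 1 / real (Suc n) * (real (Suc n) * m)) \<longlonglongrightarrow> 0 * k"
    by (intro tendsto_mult lim) real_asymp
  then have "m = 0" by (simp add: LIMSEQ_const_iff del: of_nat_Suc)
  with lim have "k = 0" by (simp add: LIMSEQ_const_iff)
  with \<open>\<alpha> = 2\<close> show ?thesis by simp
qed

section \<open>The bound on the skewness\<close>

lemma Re_stable_psi_1: "Re (stable_psi \<alpha> 1 1 0 t) = - (\<bar>t\<bar> powr \<alpha>)"
  by (simp add: stable_psi_def)

text \<open>If \<open>\<beta> > 1\<close>, convolving with the spectrally negative law that cancels the negative part of the
  exponent leaves a spectrally positive law, with finite left exponential moments. The cancelling law
  then has all exponential moments, hence a variance, which is impossible for index below 2.\<close>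

lemma skewness_le_1:
  assumes \<alpha>: "0 < \<alpha>" "\<alpha> < 2" and "0 < c" and M: "real_distribution M"
    and char: "\<And>t. char M t = exp (stable_psi \<alpha> c \<beta> \<mu> t)"
  shows "\<beta> \<le> 1"
proof (rule ccontr)
  assume "\<not> \<beta> \<le> 1"
  \<comment> \<open>The weights in \<open>stable_psi_decompose\<close> are p and - q. For \<beta> >
    1 the number q is positive, so it is itself the weight of a totally skewed law.\<close>
  define p q where "p = c powr \<alpha> * (1 + \<beta>) / 2" and "q = c powr \<alpha> * (\<beta> - 1) / 2"
  have "0 < p" "0 < q"
    using \<open>\<not> \<beta> \<le> 1\<close> \<open>0 < c\<close> by (auto simp: p_def q_def)
  obtain Z where Z: "real_distribution Z"
    "\<And>t. char Z t = exp (of_real p * stable_psi \<alpha> 1 1 0 t)"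
    "\<And>s. 0 < s \<Longrightarrow> (\<integral>\<^sup>+x. ennreal (exp (- s * x)) \<partial>Z) < \<infinity>"
    using ex_totally_skewed_law[OF \<alpha> less_imp_le[OF \<open>0 < p\<close>]] by metis
  obtain N where N: "real_distribution N"
    "\<And>t. char N t = exp (of_real q * stable_psi \<alpha> 1 1 0 t)"
    "\<And>s. 0 < s \<Longrightarrow> (\<integral>\<^sup>+x. ennreal (exp (- s * x)) \<partial>N) < \<infinity>"
    using ex_totally_skewed_law[OF \<alpha> less_imp_le[OF \<open>0 < q\<close>]] by metis
  interpret M: real_distribution M by fact
  interpret Z: real_distribution Z by fact
  interpret N: real_distribution N by fact
  let ?Z' = "distr Z borel (\<lambda>x. 1 * x + \<mu>)" and ?N' = "distr N borel (\<lambda>x. - 1 * x + 0)"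
  have Z'N': "real_distribution ?Z'" "real_distribution ?N'"
    by (intro Z.real_distribution_distr N.real_distribution_distr; simp)+
  \<comment> \<open>The reflected \<open>N\<close> has exponent q times the reflected skewed
    exponent, which cancels the part of weight - q in the exponent of \<open>M\<close>; the rest is
    that of \<open>Z\<close> shifted by \<mu>.\<close>
  have "M \<star> ?N' = ?Z'"
  proof (rule Levy_uniqueness[OF real_distribution_convolution[OF M Z'N'(2)] Z'N'(1)], rule ext)
    fix t
    have q: "c powr \<alpha> * (1 - \<beta>) / 2 = - q" by (simp add: q_def field_simps)
    show "char (M \<star> ?N') t = char ?Z' t"
      unfolding char_convolution[OF M Z'N'(2)] char_affine[OF Z(1)] char_affine[OF N(1)] Z(2) N(2) char
        stable_psi_decompose[OF less_imp_le[OF \<open>0 < c\<close>]] p_def[symmetric] q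
      by (simp flip: exp_add)
  qed
  then have "(\<integral>\<^sup>+x. ennreal (exp (- 1 * x)) \<partial>M) * (\<integral>\<^sup>+x. ennreal (exp (- 1 * x)) \<partial>?N') =
      (\<integral>\<^sup>+x. ennreal (exp (- 1 * x)) \<partial>?Z')"
    by (simp only: nn_integral_exp_convolution[OF M Z'N'(2), symmetric])
  also have "\<dots> = (\<integral>\<^sup>+x. ennreal (exp (- \<mu>)) * ennreal (exp (- 1 * x)) \<partial>Z)"
    by (subst nn_integral_distr) (auto simp: exp_diff exp_minus field_simps simp flip: ennreal_mult)
  also have "\<dots> < \<infinity>"
    using Z(3)[of 1] by (simp add: nn_integral_cmult ennreal_mult_less_top)
  finally have fin: "(\<integral>\<^sup>+x. ennreal (exp (- 1 * x)) \<partial>M) * (\<integral>\<^sup>+x. ennreal (exp (- 1 * x)) \<partial>?N') < \<infinity>" .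
  have "(\<integral>\<^sup>+x. ennreal (exp (- 1 * x)) \<partial>M) \<noteq> 0"
    by (simp add: nn_integral_0_iff_AE M.AE_False)
  \<comment> \<open>In \<open>ennreal\<close> zero times infinity is 0, so excluding a zero factor
    is what makes the other factor finite. Undoing the reflection then bounds the right exponential
    moment of \<open>N\<close>.\<close>
  with fin have "(\<integral>\<^sup>+x. ennreal (exp (- 1 * x)) \<partial>?N') < \<infinity>"
    by (auto simp: ennreal_mult_less_top)
  then have expN: "(\<integral>\<^sup>+x. ennreal (exp x) \<partial>N) < \<infinity>"
    by (subst (asm) nn_integral_distr) auto
  have "(\<integral>\<^sup>+x. ennreal (x\<^sup>2) \<partial>N) \<le>
      (\<integral>\<^sup>+x. ennreal 2 * ennreal (exp x) + ennreal 2 * ennreal (exp (- 1 * x)) \<partial>N)"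
  proof (rule nn_integral_mono)
    fix x :: real
    have "x\<^sup>2 \<le> 2 * exp \<bar>x\<bar>"
      using exp_lower_Taylor_quadratic[of "\<bar>x\<bar>"] by simp
    also have "\<dots> \<le> 2 * exp x + 2 * exp (- 1 * x)"
      by (cases "0 \<le> x") auto
    finally have "ennreal (x\<^sup>2) \<le> ennreal (2 * exp x + 2 * exp (- 1 * x))"
      by (rule ennreal_leI)
    also have "\<dots> = ennreal 2 * ennreal (exp x) + ennreal 2 * ennreal (exp (- 1 * x))"
      by (subst ennreal_plus) (simp_all add: ennreal_mult)
    finally show "ennreal (x\<^sup>2) \<le> ennreal 2 * ennreal (exp x) + ennreal 2 * ennreal (exp (- 1 * x))" .
  qed
  also have "\<dots> < \<infinity>"
    using expN N(3)[of 1] by (simp add: nn_integral_cmult nn_integral_add ennreal_mult_less_top)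
  finally have int: "integrable N (\<lambda>x. x\<^sup>2)"
    by (rule N.integrable_square_of_nn_integral)
  define K where "K = (LINT x|N. x\<^sup>2)"
  have bound: "1 - exp (- q * t powr \<alpha>) \<le> K * t\<^sup>2 / 2" if "0 < t" for t
  proof -
    have "Re (char N t) \<le> exp (- q * t powr \<alpha>)"
      using complex_Re_le_cmod[of "char N t"] that
      unfolding N(2) norm_exp_eq_Re by (simp add: Re_stable_psi_1)
    then show ?thesis
      using N.one_minus_Re_char_le[OF int, of t] by (simp add: K_def mult.commute)
  qed
  \<comment> \<open>After division of \<open>bound\<close> by t^\<alpha>, the left side tends to q
    and the right side to 0 because \<alpha> < 2; this contradicts q > 0.\<close>
  have lower: "((\<lambda>t. (1 - exp (- q * t powr \<alpha>)) / t powr \<alpha>) \<longlongrightarrow> q) (at_right 0)"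
    using \<alpha> by real_asymp
  have upper: "((\<lambda>t. K * t powr (2 - \<alpha>) / 2) \<longlongrightarrow> 0) (at_right 0)"
    using \<alpha> by real_asymp
  have "\<forall>\<^sub>F t in at_right 0. (1 - exp (- q * t powr \<alpha>)) / t powr \<alpha> \<le> K * t powr (2 - \<alpha>) / 2"
    using eventually_at_right_less[of "0::real"]
  proof eventually_elim
    case (elim t)
    have "(1 - exp (- q * t powr \<alpha>)) / t powr \<alpha> \<le> (K * t\<^sup>2 / 2) / t powr \<alpha>"
      by (intro divide_right_mono bound elim) simp
    then show ?case
      using elim by (simp add: powr_diff)
  qed
  then have "q \<le> 0"
    by (rule tendsto_le[OF trivial_limit_at_right_real upper lower])
  with \<open>0 < q\<close> show False by simp
qed

lemma cnj_stable_psi: "cnj (stable_psi \<alpha> c \<beta> \<mu> t) = stable_psi \<alpha> c \<beta> \<mu> (- t)"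
  by (simp add: stable_psi_def stable_omega_def complex_eq_iff)

lemma stable_psi_uminus: "stable_psi \<alpha> c \<beta> \<mu> (- t) = stable_psi \<alpha> c (- \<beta>) (- \<mu>) t"
  by (simp add: stable_psi_def stable_omega_def complex_eq_iff)

text \<open>Reflecting the law changes the sign of \<beta>, so the one-sided bound applies
  twice.\<close>

lemma abs_skewness_le_1:
  assumes "0 < \<alpha>" "\<alpha> < 2" "0 < c" and M: "real_distribution M"
    and char: "\<And>t. char M t = exp (stable_psi \<alpha> c \<beta> \<mu> t)"
  shows "\<bar>\<beta>\<bar> \<le> 1"
proof -
  interpret real_distribution M by fact
  have "real_distribution (distr M borel (\<lambda>x. - 1 * x + 0))"
    by (rule real_distribution_distr) simp
  moreover have "char (distr M borel (\<lambda>x. - 1 * x + 0)) t = exp (stable_psi \<alpha> c (- \<beta>) (- \<mu>) t)" for t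
    unfolding char_affine[OF M] char by (simp add: stable_psi_uminus)
  ultimately have "- \<beta> \<le> 1"
    by (rule skewness_le_1[OF assms(1-3)])
  moreover have "\<beta> \<le> 1"
    using assms by (rule skewness_le_1)
  ultimately show ?thesis by simp
qed

section \<open>Assembling the characterisation\<close>

lemma (in real_distribution) char_eq_stable_psi_of_pos:
  assumes "\<And>t. 0 < t \<Longrightarrow> char M t = exp (stable_psi \<alpha> c \<beta> \<mu> t)"
  shows "char M t = exp (stable_psi \<alpha> c \<beta> \<mu> t)"
proof (cases t "0::real" rule: linorder_cases)
  case less
  then have "char M t = cnj (exp (stable_psi \<alpha> c \<beta> \<mu> (- t)))"
    using assms[of "- t"] char_uminus[of "- t"] by simp
  then show ?thesis by (simp add: exp_cnj cnj_stable_psi)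
qed (simp_all add: assms char_zero)

lemma stable_distribution_imp_stable_psi:
  assumes "stable_distribution M"
  shows "\<exists>\<alpha> c \<beta> \<mu>. 0 < \<alpha> \<and> \<alpha> \<le> 2 \<and> 0 \<le> c \<and> \<bar>\<beta>\<bar> \<le> 1 \<and>
    (\<forall>t. char M t = exp (stable_psi \<alpha> c \<beta> \<mu> t))"
  using assms
proof (cases rule: stable_distribution_char_form)
  case (1 \<mu>)
  then show ?thesis
    \<comment> \<open>A point mass is the case c = 0, where \<alpha> = 1 and \<beta> = 0 serve as
      admissible values.\<close>
    by (intro exI[of _ 1] exI[of _ 0] exI[of _ 0] exI[of _ \<mu>]) (simp add: stable_psi_def)
next
  case (2 \<alpha> C \<mu> k)
  have M: "real_distribution M" using assms by (simp add: stable_distribution_def)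
  interpret real_distribution M by (rule M)
  define c where "c = C powr (1 / \<alpha>)"
  have c: "0 < c" "c powr \<alpha> = C"
    using 2 by (auto simp: c_def powr_powr)
  have ct: "\<bar>c * t\<bar> powr \<alpha> = C * t powr \<alpha>" if "0 < t" for t
    using that c by (simp add: abs_mult powr_mult)
  show ?thesis
  proof (cases "\<alpha> < 2")
    case True
    \<comment> \<open>The coefficient of \<open>stable_omega\<close>, with ln t split off when
      \<alpha> = 1. It is nonzero for \<alpha> < 2, so k = C \<beta> \<omega> can be solved for
      \<beta>.\<close>
    define \<omega> where "\<omega> = (if \<alpha> = 1 then - 2 / pi else tan (pi / 2 * \<alpha>))"
    have "\<omega> \<noteq> 0"
    proof (cases "\<alpha> = 1")
      case False
      have "pi / 2 * \<alpha> \<noteq> 0" "sin (pi / 2 * \<alpha>) > 0"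
        using \<open>0 < \<alpha>\<close> True by (auto intro!: sin_gt_zero)
      moreover have "cos (pi / 2 * \<alpha>) \<noteq> 0"
        using sgn_times_cos_half_pi[OF \<open>0 < \<alpha>\<close> True False] by auto
      ultimately show ?thesis using False by (simp add: \<omega>_def tan_def)
    qed (simp add: \<omega>_def)
    define \<beta> where "\<beta> = k / (C * \<omega>)"
    have "char M t = exp (stable_psi \<alpha> c \<beta> \<mu> t)" for t
    proof (rule char_eq_stable_psi_of_pos)
      fix t :: real assume t: "0 < t"
      have "C * t powr \<alpha> * (\<beta> * stable_omega \<alpha> t) = k * (if \<alpha> = 1 then t * ln t else t powr \<alpha>)"
        using \<open>\<omega> \<noteq> 0\<close> \<open>0 < C\<close> t by (auto simp: \<beta>_def \<omega>_def stable_omega_def)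
      then show "char M t = exp (stable_psi \<alpha> c \<beta> \<mu> t)"
        unfolding 2(3)[OF t] stable_psi_def ct[OF t] using t
        by (intro arg_cong[of _ _ exp]) (simp add: complex_eq_iff)
    qed
    moreover from this have "\<bar>\<beta>\<bar> \<le> 1"
      by (rule abs_skewness_le_1[OF \<open>0 < \<alpha>\<close> True c(1) M])
    ultimately show ?thesis
      using \<open>0 < \<alpha>\<close> True c(1) by (metis less_imp_le)
  next
    case False
    \<comment> \<open>Recentring by \<mu> removes the drift, which brings the characteristic
      function to the form treated by \<open>index_le_2\<close>.\<close>
    let ?N = "distr M borel (\<lambda>x. 1 * x + - \<mu>)"
    interpret N: real_distribution ?N by (rule real_distribution_distr) simp
    have "\<alpha> = 2 \<and> k = 0"
    proof (rule N.index_le_2)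
      show "char ?N t = exp (of_real (t powr \<alpha>) * (- of_real C + \<i> * of_real k))" if "0 < t" for t
        unfolding char_affine[OF M] using 2(3)[OF that] False
        by (simp add: exp_add[symmetric] algebra_simps)
    qed (use 2 False in auto)
    then have \<alpha>k: "\<alpha> = 2" "k = 0" by auto
    have "char M t = exp (stable_psi 2 c 0 \<mu> t)" for t
    proof (rule char_eq_stable_psi_of_pos)
      show "char M t = exp (stable_psi 2 c 0 \<mu> t)" if "0 < t" for t
        using ct[OF that] unfolding 2(3)[OF that] stable_psi_def \<alpha>k by simp
    qed
    then show ?thesis
      using c(1) by (intro exI[of _ 2] exI[of _ c] exI[of _ 0] exI[of _ \<mu>]) simp
  qed
qed

theorem theorem1p1:
  fixes \<phi> :: "real \<Rightarrow> complex"
  shows "(\<exists>M. stable_distribution M \<and> \<phi> = char M) \<longleftrightarrow>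
         (\<exists>\<alpha> c \<beta> \<mu> :: real. 0 < \<alpha> \<and> \<alpha> \<le> 2 \<and> 0 \<le> c \<and> \<bar>\<beta>\<bar> \<le> 1 \<and>
            (\<forall>t::real. \<phi> t = exp (stable_psi \<alpha> c \<beta> \<mu> t)))"
proof
  assume "\<exists>M. stable_distribution M \<and> \<phi> = char M"
  then show "\<exists>\<alpha> c \<beta> \<mu> :: real. 0 < \<alpha> \<and> \<alpha> \<le> 2 \<and> 0 \<le> c \<and> \<bar>\<beta>\<bar> \<le> 1 \<and>
      (\<forall>t::real. \<phi> t = exp (stable_psi \<alpha> c \<beta> \<mu> t))"
    using stable_distribution_imp_stable_psi by metis
next
  assume "\<exists>\<alpha> c \<beta> \<mu> :: real. 0 < \<alpha> \<and> \<alpha> \<le> 2 \<and> 0 \<le> c \<and> \<bar>\<beta>\<bar> \<le> 1 \<and>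
      (\<forall>t::real. \<phi> t = exp (stable_psi \<alpha> c \<beta> \<mu> t))"
  then obtain \<alpha> c \<beta> \<mu> where "0 < \<alpha>" "\<alpha> \<le> 2" "0 \<le> c" "\<bar>\<beta>\<bar> \<le> 1"
    and \<phi>: "\<And>t. \<phi> t = exp (stable_psi \<alpha> c \<beta> \<mu> t)"
    by blast
  then obtain M where "stable_distribution M" "char M = (\<lambda>t. exp (stable_psi \<alpha> c \<beta> \<mu> t))"
    using ex_stable_distribution by blast
  then show "\<exists>M. stable_distribution M \<and> \<phi> = char M"
    using \<phi> by (intro exI[of _ M]) auto
qed

end
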